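(* Let $n=2r\geq 2$ and let $(\varphi^{U}_{p\bar p'})$ be the unitary $(1,1)$-curvature of the Chern connection attached to $q=1$. Then $\varphi^{U}_{p\bar p'}\neq 0$ for all $p,p'\in\mathcal V$.
   Context: Let $M$ be an even positive integer, $N\geq 1$, $\zeta_N$ a primitive $N$-th root of unity, and $A=\mathbb{Z}[1/M,\zeta_N]$. Let $\mathcal V$ be a (possibly infinite) set of rational primes not dividing $MN$. For a ring $B$, $B^{\widehat{p}}$ denotes its $p$-adic completion. For $p\in\mathcal V$ there is a unique ring endomorphism $\phi_p$ of $A$ lifting the $p$-power Frobenius of $A/pA$; it extends to $A^{\widehat p}$. A $p$-derivation on a $p$-torsion free ring $B$ is a map $\delta_p:B\to B$ such that $\phi_p(b):=b^p+p\delta_p(b)$ is a ring homomorphism (its Frobenius lift). Let $G=GL_n$ over $A$, $\mathcal O(G)=A[x,\det(x)^{-1}]$ with $x$ an $n\times n$ matrix of indeterminates; $u^t$ denotes transpose and $u^{(p)}$ the entrywise $p$-th power. Let $T=x-1$. For the Chern connection attached to $q=1$, the Frobenius lift $\phi_p$ is the ring endomorphism of $\mathcal O(G)^{\widehat p}$ extending $\phi_p$ on $A^{\widehat p}$ with $\phi_p(x)=x^{(p)}\{(x^{(p)t}x^{(p)})^{-1}(x^tx)^{(p)}\}^{1/2}$ (square root via the binomial series $(1+u)^{1/2}=1+\sum_{i\ge1}\binom{1/2}{i}u^i$); it maps the ideal generated by the entries of $T$ into itself and induces an endomorphism $\phi_p$ of $A[[T]]$. Let $\phi_{\bar p}$ be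 the ring endomorphism of $A[[T]]$ extending $\phi_p$ on $A$ with $x\mapsto x^{(p)}$, i.e. $T\mapsto(1+T)^{(p)}-1$ (Frobenius lift of the trivial connection $\delta_{\bar p}x=0$). The $(1,1)$-curvature is $\varphi_{p\bar p'}:=\frac{1}{pp'}(\phi_p\phi_{\bar p'}-\phi_{\bar p'}\phi_p)$ for $p\neq p'$ and $\varphi_{p\bar p}:=\frac1p(\phi_p\phi_{\bar p}-\phi_{\bar p}\phi_p)$, as $\mathbb{Z}$-module endomorphisms of $A[[T]]$. Write $x=\begin{pmatrix}a&b\\c&d\end{pmatrix}$ with $r\times r$ blocks, and let $K$ be the ideal of $A[[T]]$ generated by the entries of $x^tx-1$, $a-d$, $b+c$ (both $\phi_p$ and $\phi_{\bar p}$ map $K$ into $K$). The unitary $(1,1)$-curvature $\varphi^U_{p\bar p'}$ is the $\mathbb{Z}$-module endomorphism of $A[[T]]/K$ induced by $\varphi_{p\bar p'}$.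
   Formalization: The trivial lift and the curvature do not map K into K, so the induced endomorphism of A[[T]]/K is not well defined; "nonzero" is read as: some f in A[[T]] has curvature image outside K (the induced relation on classes is not zero), which is the usual meaning whenever the induced map exists. *)

theory Defs
  imports
    "HOL-Analysis.Cartesian_Space"
    "HOL-Algebra.Algebraic_Closure_Type"
    "HOL-Algebra.Generated_Rings"
    "HOL-Algebra.QuotRing"
    "HOL-Library.Function_Algebras"
    "HOL-Library.Groups_Big_Fun"
begin

section \<open>Power series in several variables\<close>

text \<open>
  A series in the variables \<open>'v\<close> is given by its coefficients; \<open>\<alpha> :: 'v \<Rightarrow> nat\<close> is the
  exponent of a monomial, and exponents are added pointwise.
\<close>

typedef ('v, 'a) mps = "UNIV :: (('v \<Rightarrow> nat) \<Rightarrow> 'a) set"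
  morphisms mps_coeff Abs_mps ..

lemma mps_coeff_Abs [simp]: "mps_coeff (Abs_mps f) = f"
  by (simp add: Abs_mps_inverse)

lemma mps_eqI: "(\<And>\<alpha>. mps_coeff f \<alpha> = mps_coeff g \<alpha>) \<Longrightarrow> f = g"
  by (metis mps_coeff_inject ext)

definition antidiag :: "('v \<Rightarrow> nat) \<Rightarrow> (('v \<Rightarrow> nat) \<times> ('v \<Rightarrow> nat)) set"
  where "antidiag \<alpha> = {(\<beta>, \<gamma>). \<beta> + \<gamma> = \<alpha>}"

lemma mem_antidiag [simp]: "(\<beta>, \<gamma>) \<in> antidiag \<alpha> \<longleftrightarrow> \<beta> + \<gamma> = \<alpha>"
  by (simp add: antidiag_def)

lemma finite_antidiag [simp]: "finite (antidiag (\<alpha> :: 'v::finite \<Rightarrow> nat))"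
proof -
  let ?B = "{..Max (range \<alpha>)}"
  let ?F = "{f :: 'v \<Rightarrow> nat. \<forall>v. (v \<in> UNIV \<longrightarrow> f v \<in> ?B) \<and> (v \<notin> UNIV \<longrightarrow> f v = 0)}"
  have fin: "finite ?F"
    by (rule finite_set_of_finite_funs) auto
  have "antidiag \<alpha> \<subseteq> ?F \<times> ?F"
  proof
    fix z assume "z \<in> antidiag \<alpha>"
    then obtain \<beta> \<gamma> where z: "z = (\<beta>, \<gamma>)" and eq: "\<beta> + \<gamma> = \<alpha>"
      by (cases z) auto
    have "\<beta> v + \<gamma> v \<le> Max (range \<alpha>)" for v
      using fun_cong[OF eq, of v] by (simp add: Max_ge)
    then have "\<beta> v \<le> Max (range \<alpha>) \<and> \<gamma> v \<le> Max (range \<alpha>)" for v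
      using add_leD1 add_leD2 by blast
    then show "z \<in> ?F \<times> ?F" by (simp add: z)
  qed
  then show ?thesis
    using finite_subset fin by blast
qed

instantiation mps :: (finite, comm_ring_1) comm_ring_1
begin

definition zero_mps_def: "0 = Abs_mps (\<lambda>_. 0)"
definition one_mps_def: "1 = Abs_mps (\<lambda>\<alpha>. if \<alpha> = 0 then 1 else 0)"
definition plus_mps_def: "f + g = Abs_mps (\<lambda>\<alpha>. mps_coeff f \<alpha> + mps_coeff g \<alpha>)"
definition minus_mps_def: "f - g = Abs_mps (\<lambda>\<alpha>. mps_coeff f \<alpha> - mps_coeff g \<alpha>)"
definition uminus_mps_def: "- f = Abs_mps (\<lambda>\<alpha>. - mps_coeff f \<alpha>)"
definition times_mps_def:
  "f * g = Abs_mps (\<lambda>\<alpha>. \<Sum>(\<beta>, \<gamma>)\<in>antidiag \<alpha>. mps_coeff f \<beta> * mps_coeff g \<gamma>)"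

lemmas mps_ops_defs =
  zero_mps_def one_mps_def plus_mps_def minus_mps_def uminus_mps_def times_mps_def

instance
proof
  fix f g h :: "('a, 'b) mps"
  show "f * g * h = f * (g * h)"
  proof (rule mps_eqI)
    fix \<alpha> :: "'a \<Rightarrow> nat"
    let ?c = "\<lambda>\<beta> \<gamma> \<delta>. mps_coeff f \<beta> * mps_coeff g \<gamma> * mps_coeff h \<delta>"
    have "mps_coeff (f * g * h) \<alpha> =
        (\<Sum>(\<epsilon>, \<delta>)\<in>antidiag \<alpha>. \<Sum>(\<beta>, \<gamma>)\<in>antidiag \<epsilon>. ?c \<beta> \<gamma> \<delta>)"
      by (simp add: times_mps_def sum_distrib_right case_prod_unfold)
    also have "\<dots> = (\<Sum>z\<in>(SIGMA z:antidiag \<alpha>. antidiag (fst z)).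
        ?c (fst (snd z)) (snd (snd z)) (snd (fst z)))"
      by (simp add: sum.Sigma case_prod_unfold)
    also have "\<dots> = (\<Sum>z\<in>(SIGMA z:antidiag \<alpha>. antidiag (snd z)).
        ?c (fst (fst z)) (fst (snd z)) (snd (snd z)))"
      by (rule sum.reindex_bij_witness[where
            i = "\<lambda>((\<beta>, \<epsilon>), (\<gamma>, \<delta>)). ((\<beta> + \<gamma>, \<delta>), (\<beta>, \<gamma>))" and
            j = "\<lambda>((\<epsilon>, \<delta>), (\<beta>, \<gamma>)). ((\<beta>, \<gamma> + \<delta>), (\<gamma>, \<delta>))"])
        (auto simp: add.assoc)
    also have "\<dots> = (\<Sum>(\<beta>, \<epsilon>)\<in>antidiag \<alpha>. \<Sum>(\<gamma>, \<delta>)\<in>antidiag \<epsilon>. ?c \<beta> \<gamma> \<delta>)"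
      by (simp add: sum.Sigma case_prod_unfold)
    also have "\<dots> = mps_coeff (f * (g * h)) \<alpha>"
      by (simp add: times_mps_def sum_distrib_left case_prod_unfold mult.assoc)
    finally show "mps_coeff (f * g * h) \<alpha> = mps_coeff (f * (g * h)) \<alpha>" .
  qed
  show "f * g = g * f"
  proof (rule mps_eqI)
    fix \<alpha> :: "'a \<Rightarrow> nat"
    have "(\<Sum>(\<beta>, \<gamma>)\<in>antidiag \<alpha>. mps_coeff f \<beta> * mps_coeff g \<gamma>) =
        (\<Sum>(\<beta>, \<gamma>)\<in>antidiag \<alpha>. mps_coeff g \<beta> * mps_coeff f \<gamma>)"
      by (rule sum.reindex_bij_witness[where i = prod.swap and j = prod.swap])
        (auto simp: add.commute mult.commute)
    then show "mps_coeff (f * g) \<alpha> = mps_coeff (g * f) \<alpha>"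
      by (simp add: times_mps_def)
  qed
  show "1 * f = f"
  proof (rule mps_eqI)
    fix \<alpha> :: "'a \<Rightarrow> nat"
    have "mps_coeff (1 * f) \<alpha> =
        (\<Sum>(\<beta>, \<gamma>)\<in>antidiag \<alpha>. (if \<beta> = 0 then 1 else 0) * mps_coeff f \<gamma>)"
      by (simp add: times_mps_def one_mps_def)
    also have "\<dots> = (\<Sum>(\<beta>, \<gamma>)\<in>{(0 :: 'a \<Rightarrow> nat, \<alpha>)}. (if \<beta> = 0 then 1 else 0) * mps_coeff f \<gamma>)"
      by (rule sum.mono_neutral_right) (auto split: if_splits)
    finally show "mps_coeff (1 * f) \<alpha> = mps_coeff f \<alpha>" by simp
  qed
  show "(f + g) * h = f * h + g * h"
    by (rule mps_eqI)
      (simp add: times_mps_def plus_mps_def distrib_right case_prod_unfold sum.distrib)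
  show "(0 :: ('a, 'b) mps) \<noteq> 1"
  proof
    assume "(0 :: ('a, 'b) mps) = 1"
    then have "mps_coeff (0 :: ('a, 'b) mps) 0 = mps_coeff 1 0" by simp
    then show False by (simp add: zero_mps_def one_mps_def)
  qed
qed (rule mps_eqI, simp add: mps_ops_defs algebra_simps)+

end

definition mps_const :: "'a::zero \<Rightarrow> ('v, 'a) mps"
  where "mps_const c = Abs_mps (\<lambda>\<alpha>. if \<alpha> = 0 then c else 0)"

definition mps_var :: "'v \<Rightarrow> ('v, 'a::zero_neq_one) mps"
  where "mps_var v = Abs_mps (\<lambda>\<alpha>. if \<alpha> = (\<lambda>w. if w = v then 1 else 0) then 1 else 0)"

text \<open>
  Sum of a family that converges for the adic topology of the ideal of the variables: each
  coefficient is a sum with only finitely many nonzero terms, which is what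
  \<^const>\<open>Sum_any\<close> computes.
\<close>

definition mps_sum :: "('i \<Rightarrow> ('v, 'a::comm_monoid_add) mps) \<Rightarrow> ('v, 'a) mps"
  where "mps_sum F = Abs_mps (\<lambda>\<alpha>. Sum_any (\<lambda>i. mps_coeff (F i) \<alpha>))"

text \<open>
  The map acting by \<open>\<sigma>\<close> on coefficients and sending the variable \<open>v\<close> to \<open>F v\<close>. It is only
  used when all the \<open>F v\<close> have constant term 0, so that the sum converges in the above sense.
\<close>

definition mps_subst ::
  "('a \<Rightarrow> 'a) \<Rightarrow> ('v \<Rightarrow> ('v, 'a) mps) \<Rightarrow> ('v, 'a) mps \<Rightarrow> ('v::finite, 'a::comm_ring_1) mps"
  where "mps_subst \<sigma> F f =
    mps_sum (\<lambda>\<alpha>. mps_const (\<sigma> (mps_coeff f \<alpha>)) * (\<Prod>v\<in>UNIV. F v ^ \<alpha> v))"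


section \<open>The rings \<open>A\<close> and \<open>A[[T]]\<close>\<close>

definition ring_A :: "nat \<Rightarrow> complex \<Rightarrow> complex ring"
  where "ring_A M \<zeta> =
    ring_of_type_algebra\<lparr>carrier := generate_ring ring_of_type_algebra {1 / of_nat M, \<zeta>}\<rparr>"

definition frobenius_lift :: "('a, 'b) ring_scheme \<Rightarrow> nat \<Rightarrow> ('a \<Rightarrow> 'a) \<Rightarrow> bool"
  where "frobenius_lift R p \<phi> \<longleftrightarrow> \<phi> \<in> ring_hom R R \<and>
    (\<forall>a\<in>carrier R. \<exists>b\<in>carrier R. \<phi> a = (a [^]\<^bsub>R\<^esub> p) \<oplus>\<^bsub>R\<^esub> ([p] \<cdot>\<^bsub>R\<^esub> b))"

text \<open>The variables are the entries of the matrix \<open>T\<close>, indexed by \<open>'n \<times> 'n\<close>.\<close>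

definition ring_AT :: "nat \<Rightarrow> complex \<Rightarrow> ('n::finite \<times> 'n, complex) mps ring"
  where "ring_AT M \<zeta> =
    ring_of_type_algebra\<lparr>carrier := {f. \<forall>\<alpha>. mps_coeff f \<alpha> \<in> carrier (ring_A M \<zeta>)}\<rparr>"

definition x_mat :: "('n \<times> 'n, complex) mps ^ 'n ^ 'n::finite"
  where "x_mat = mat 1 + (\<chi> i j. mps_var (i, j))"


section \<open>The Frobenius lifts of the Chern and of the trivial connection\<close>

definition entry_power :: "'a::power ^ 'n ^ 'm \<Rightarrow> nat \<Rightarrow> 'a ^ 'n ^ 'm"
  where "entry_power B p = (\<chi> i j. (B $ i $ j) ^ p)"

definition mat_power :: "'a::semiring_1 ^ 'n ^ 'n \<Rightarrow> nat \<Rightarrow> 'a ^ 'n ^ 'n"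
  where "mat_power B k = (((**) B) ^^ k) (mat 1)"

text \<open>
  The binomial series \<open>(1 + U)\<^bsup>1/2\<^esup>\<close>, for a matrix \<open>U\<close> whose entries have constant term 0.
\<close>

definition mat_binomial_sqrt ::
  "('v::finite, complex) mps ^ 'n ^ 'n \<Rightarrow> ('v, complex) mps ^ 'n ^ 'n"
  where "mat_binomial_sqrt U =
    (\<chi> i j. mps_sum (\<lambda>k. mps_const ((1/2) gchoose k) * mat_power U k $ i $ j))"

text \<open>
  The image of \<open>x\<close> under the Frobenius lift of the Chern connection attached to \<open>q = 1\<close>. The
  argument of the square root is congruent to 1 modulo \<open>T\<close>, and each coefficient of the binomial
  series is a finite sum in \<open>\<int>[1/2]\<close>. The expansion at \<open>x = 1\<close> of the \<open>p\<close>-adic binomial series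
  in the completed coordinate ring of \<open>GL\<^sub>n\<close> has the same coefficients, the series being the
  same one.
\<close>

definition chern_image :: "nat \<Rightarrow> ('n \<times> 'n, complex) mps ^ 'n ^ 'n::finite"
  where "chern_image p =
    (let xp = entry_power x_mat p in
     xp ** mat_binomial_sqrt
       (matrix_inv (transpose xp ** xp) ** entry_power (transpose x_mat ** x_mat) p - mat 1))"

text \<open>
  Both lifts below are given by \<open>T \<mapsto> \<Phi> - 1\<close>, where \<open>\<Phi>\<close> is the image of \<open>x\<close>; \<open>\<sigma>\<close> is the
  Frobenius lift on \<open>A\<close>. The second one is \<open>\<phi>\<close> with index \<open>p\<close>-bar.
\<close>

definition chern_frob ::
  "(complex \<Rightarrow> complex) \<Rightarrow> nat \<Rightarrow> ('n \<times> 'n, complex) mps \<Rightarrow> ('n::finite \<times> 'n, complex) mps"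
  where "chern_frob \<sigma> p = mps_subst \<sigma> (\<lambda>(i, j). (chern_image p - mat 1) $ i $ j)"

definition triv_frob ::
  "(complex \<Rightarrow> complex) \<Rightarrow> nat \<Rightarrow> ('n \<times> 'n, complex) mps \<Rightarrow> ('n::finite \<times> 'n, complex) mps"
  where "triv_frob \<sigma> p = mps_subst \<sigma> (\<lambda>(i, j). (entry_power x_mat p - mat 1) $ i $ j)"


section \<open>Curvature\<close>

text \<open>
  \<open>\<sigma> p\<close> is the Frobenius lift on \<open>A\<close> at \<open>p\<close>. The division takes place in complex power series;
  the commutator of the Frobenius lifts is divisible by the denominator already in \<open>A[[T]]\<close>.
\<close>

definition curvature11 ::
  "(nat \<Rightarrow> complex \<Rightarrow> complex) \<Rightarrow> nat \<Rightarrow> nat \<Rightarrow>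
    ('n \<times> 'n, complex) mps \<Rightarrow> ('n::finite \<times> 'n, complex) mps"
  where "curvature11 \<sigma> p p' f =
    mps_const (1 / of_nat (if p = p' then p else p * p')) *
      (chern_frob (\<sigma> p) p (triv_frob (\<sigma> p') p' f) - triv_frob (\<sigma> p') p' (chern_frob (\<sigma> p) p f))"

text \<open>
  The index type \<open>'r + 'r\<close> of cardinality \<open>n = 2r\<close> splits \<open>x\<close> into the \<open>r \<times> r\<close> blocks
  \<open>a\<close>, \<open>b\<close> (first row) and \<open>c\<close>, \<open>d\<close> (second row).
\<close>

definition unitary_ideal ::
  "nat \<Rightarrow> complex \<Rightarrow> (('r::finite + 'r) \<times> ('r + 'r), complex) mps set"
  where "unitary_ideal M \<zeta> = genideal (ring_AT M \<zeta>)
     ({(transpose x_mat ** x_mat - mat 1) $ i $ j |i j. True} \<union>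
      {x_mat $ Inl i $ Inl j - x_mat $ Inr i $ Inr j |i j. True} \<union>
      {x_mat $ Inl i $ Inr j + x_mat $ Inr i $ Inl j |i j. True})"

text \<open>
  The map on \<open>R/K\<close> induced by \<open>\<psi> : R \<rightarrow> R\<close>, as a graph: the class of \<open>f\<close> is sent to the class
  of \<open>\<psi> f\<close>. For additive \<open>\<psi>\<close> this is the graph of a function iff \<open>\<psi>\<close> maps \<open>K\<close> into \<open>K\<close>.
  The definition does not presuppose this. It fails for the unitary ideal and the trivial lift:
  for \<open>r = 1\<close>, \<open>p = 3\<close>, modulo \<open>K\<close> the entry \<open>a\<^sup>2 + c\<^sup>2 - 1\<close> of \<open>x\<^sup>t x - 1\<close> is sent to
  \<open>a\<^sup>6 + b\<^sup>6 - 1 = - 3 a\<^sup>2 b\<^sup>2\<close>.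
\<close>

definition induced_graph ::
  "('a, 'b) ring_scheme \<Rightarrow> 'a set \<Rightarrow> ('a \<Rightarrow> 'a) \<Rightarrow> ('a set \<times> 'a set) set"
  where "induced_graph R K \<psi> = {(K +>\<^bsub>R\<^esub> f, K +>\<^bsub>R\<^esub> \<psi> f) |f. f \<in> carrier R}"

definition unitary_curvature ::
  "nat \<Rightarrow> complex \<Rightarrow> (nat \<Rightarrow> complex \<Rightarrow> complex) \<Rightarrow> nat \<Rightarrow> nat \<Rightarrow>
    ((('r::finite + 'r) \<times> ('r + 'r), complex) mps set \<times>
     (('r + 'r) \<times> ('r + 'r), complex) mps set) set"
  where "unitary_curvature M \<zeta> \<sigma> p p' =
    induced_graph (ring_AT M \<zeta>) (unitary_ideal M \<zeta>) (curvature11 \<sigma> p p')"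

end

theory Submission
  imports Defs "HOL-Computational_Algebra.Formal_Power_Series"
begin

no_notation fps_nth (infixl "$" 75)

text \<open>
  Rotating by the angle \<open>t\<close> in a coordinate plane \<open>(k, r + k)\<close> is a curve in the unitary group
  through 1, so evaluating power series along it gives a homomorphism to \<open>\<complex>[[t]]\<close> that kills \<open>K\<close>.
  Along a curve whose diagonal has no linear term, the diagonal of \<open>\<phi>\<^sub>p(x)\<close> is, modulo \<open>t\<^sup>3\<close>,
  \<open>1 + p/2\<close> times the quadratic term of \<open>x\<^sup>t x\<close>. For the entry \<open>x\<^sub>k\<^sub>k\<close> the composite in which the
  Chern lift is applied to the orthogonal curve itself therefore has no quadratic term, while in
  the other one the curve has first been replaced by its entrywise \<open>p'\<close>-th power, with
  \<open>x\<^sup>t x = 1 - p' t\<^sup>2\<close> in the plane, and the quadratic coefficient is \<open>- p p' / 2\<close>.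
\<close>

section \<open>Order of vanishing and evaluation\<close>

definition mps_degree :: "('v::finite \<Rightarrow> nat) \<Rightarrow> nat"
  where "mps_degree \<alpha> = sum \<alpha> UNIV"

text \<open>Membership in the \<open>d\<close>-th power of the ideal of the variables, read off on
  coefficients. Tracking this order turns every infinite sum below into a finite one in each
  degree.\<close>

definition mps_vanish :: "nat \<Rightarrow> ('v::finite, 'a::comm_ring_1) mps \<Rightarrow> bool"
  where "mps_vanish d f \<longleftrightarrow> (\<forall>\<alpha>. mps_degree \<alpha> < d \<longrightarrow> mps_coeff f \<alpha> = 0)"

lemma mps_degree_zero [simp]: "mps_degree 0 = 0"
  by (simp add: mps_degree_def)

lemma mps_degree_add: "mps_degree (\<alpha> + \<beta>) = mps_degree \<alpha> + mps_degree \<beta>"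
  by (simp add: mps_degree_def sum.distrib)

lemma mps_degree_eq_0_iff [simp]: "mps_degree \<alpha> = 0 \<longleftrightarrow> \<alpha> = 0"
  by (auto simp: mps_degree_def)

lemma finite_mps_degree_le: "finite {\<alpha> :: 'v::finite \<Rightarrow> nat. mps_degree \<alpha> \<le> n}"
proof -
  let ?F = "{f :: 'v \<Rightarrow> nat. \<forall>v. (v \<in> UNIV \<longrightarrow> f v \<in> {..n}) \<and> (v \<notin> UNIV \<longrightarrow> f v = 0)}"
  have "finite ?F"
    by (rule finite_set_of_finite_funs) auto
  moreover have "{\<alpha> :: 'v \<Rightarrow> nat. mps_degree \<alpha> \<le> n} \<subseteq> ?F"
  proof
    fix \<alpha> :: "'v \<Rightarrow> nat"
    assume "\<alpha> \<in> {\<alpha>. mps_degree \<alpha> \<le> n}"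
    moreover have "\<alpha> v \<le> mps_degree \<alpha>" for v
      unfolding mps_degree_def by (rule member_le_sum) auto
    ultimately show "\<alpha> \<in> ?F"
      using order_trans by auto
  qed
  ultimately show ?thesis
    by (rule finite_subset[rotated])
qed

lemma mps_coeff_simps [simp]:
  "mps_coeff 0 \<alpha> = 0"
  "mps_coeff 1 \<alpha> = (if \<alpha> = 0 then 1 else 0)"
  "mps_coeff (f + g) \<alpha> = mps_coeff f \<alpha> + mps_coeff g \<alpha>"
  "mps_coeff (f - g) \<alpha> = mps_coeff f \<alpha> - mps_coeff g \<alpha>"
  "mps_coeff (- f) \<alpha> = - mps_coeff f \<alpha>"
  "mps_coeff (mps_const c) \<alpha> = (if \<alpha> = 0 then c else 0)"
  by (simp_all add: mps_ops_defs mps_const_def)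

lemma mps_coeff_mult:
  "mps_coeff (f * g) \<alpha> = (\<Sum>(\<beta>, \<gamma>)\<in>antidiag \<alpha>. mps_coeff f \<beta> * mps_coeff g \<gamma>)"
  by (simp add: times_mps_def)

lemma mps_coeff_sum: "mps_coeff (sum f I) \<alpha> = (\<Sum>i\<in>I. mps_coeff (f i) \<alpha>)"
  by (induction I rule: infinite_finite_induct) auto

lemma mps_coeff_mult_0 [simp]:
  fixes f g :: "('v::finite, 'a::comm_ring_1) mps"
  shows "mps_coeff (f * g) 0 = mps_coeff f 0 * mps_coeff g 0"
proof -
  have "antidiag (0 :: 'v \<Rightarrow> nat) = {(0, 0)}"
    by (auto simp: antidiag_def fun_eq_iff)
  then show ?thesis
    by (simp add: mps_coeff_mult)
qed

lemma mps_vanish_0 [simp]: "mps_vanish 0 f"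
  by (simp add: mps_vanish_def)

lemma mps_vanish_Suc_0: "mps_vanish (Suc 0) f \<longleftrightarrow> mps_coeff f 0 = 0"
  by (auto simp: mps_vanish_def)

text \<open>If two exponents add up to degree below \<open>d + e\<close>, one of them lies below its
  own bound, so each term of the convolution has a zero factor.\<close>

lemma mps_vanish_mult:
  assumes "mps_vanish d f" "mps_vanish e g"
  shows "mps_vanish (d + e) (f * g)"
  unfolding mps_vanish_def
proof (intro allI impI)
  fix \<alpha> :: "'a \<Rightarrow> nat"
  assume deg: "mps_degree \<alpha> < d + e"
  have "mps_coeff f \<beta> * mps_coeff g \<gamma> = 0" if "\<beta> + \<gamma> = \<alpha>" for \<beta> \<gamma>
  proof -
    have "mps_degree \<beta> < d \<or> mps_degree \<gamma> < e"
      using deg that mps_degree_add by (metis add_mono not_le)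
    then show ?thesis
      using assms by (auto simp: mps_vanish_def)
  qed
  then show "mps_coeff (f * g) \<alpha> = 0"
    by (auto simp: mps_coeff_mult intro!: sum.neutral)
qed

lemma mps_vanish_sum: "(\<And>i. i \<in> I \<Longrightarrow> mps_vanish d (f i)) \<Longrightarrow> mps_vanish d (sum f I)"
  by (simp add: mps_vanish_def mps_coeff_sum)

lemma mps_vanish_power: "mps_vanish d f \<Longrightarrow> mps_vanish (d * n) (f ^ n)"
  by (induction n) (auto dest: mps_vanish_mult)

lemma mps_vanish_prod:
  "(\<And>i. i \<in> I \<Longrightarrow> mps_vanish (d i) (f i)) \<Longrightarrow> mps_vanish (sum d I) (prod f I)"
  by (induction I rule: infinite_finite_induct) (auto intro: mps_vanish_mult)

section \<open>Evaluation at a tuple of one-variable power series\<close>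

definition fps_monom :: "('v::finite \<Rightarrow> 'a::comm_ring_1 fps) \<Rightarrow> ('v \<Rightarrow> nat) \<Rightarrow> 'a fps"
  where "fps_monom P \<alpha> = (\<Prod>v\<in>UNIV. P v ^ \<alpha> v)"

text \<open>The value at a point \<open>P\<close>, seen as a formal curve in the variable t. The
  cutoff at degree \<open>n\<close> is the right one when every \<open>P v\<close> lacks a constant
  term, for then a monomial of higher degree has no coefficient at t^n.\<close>

definition mps_eval :: "('v::finite \<Rightarrow> 'a::comm_ring_1 fps) \<Rightarrow> ('v, 'a) mps \<Rightarrow> 'a fps"
  where "mps_eval P f = Abs_fps (\<lambda>n. \<Sum>\<alpha> | mps_degree \<alpha> \<le> n.
    mps_coeff f \<alpha> * fps_nth (fps_monom P \<alpha>) n)"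

lemma fps_monom_add: "fps_monom P (\<alpha> + \<beta>) = fps_monom P \<alpha> * fps_monom P \<beta>"
  by (simp add: fps_monom_def power_add prod.distrib)

lemma fps_monom_zero [simp]: "fps_monom P 0 = 1"
  by (simp add: fps_monom_def)

lemma mps_eval_nth:
  "fps_nth (mps_eval P f) n = (\<Sum>\<alpha> | mps_degree \<alpha> \<le> n. mps_coeff f \<alpha> * fps_nth (fps_monom P \<alpha>) n)"
  by (simp add: mps_eval_def)

lemma fps_nth_mult_below:
  fixes f g :: "'a::comm_ring_1 fps"
  assumes f: "\<And>n. n < d \<Longrightarrow> fps_nth f n = 0" and g: "\<And>n. n < e \<Longrightarrow> fps_nth g n = 0"
    and n: "n < d + e"
  shows "fps_nth (f * g) n = 0"
  unfolding fps_mult_nth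
proof (rule sum.neutral, intro ballI)
  fix i assume "i \<in> {0..n}"
  with n have "i < d \<or> n - i < e" by auto
  then show "fps_nth f i * fps_nth g (n - i) = 0"
    using f g by auto
qed

lemma fps_nth_power_below:
  fixes f :: "'a::comm_ring_1 fps"
  shows "(\<And>n. n < d \<Longrightarrow> fps_nth f n = 0) \<Longrightarrow> n < d * k \<Longrightarrow> fps_nth (f ^ k) n = 0"
proof (induction k arbitrary: n)
  case (Suc k)
  show ?case
    unfolding power_Suc
    by (rule fps_nth_mult_below[where d = d and e = "d * k"]) (use Suc in auto)
qed auto

lemma fps_nth_prod_below:
  fixes f :: "'i \<Rightarrow> 'a::comm_ring_1 fps"
  shows "finite I \<Longrightarrow> (\<And>i n. i \<in> I \<Longrightarrow> n < d i \<Longrightarrow> fps_nth (f i) n = 0) \<Longrightarrow> n < sum d I \<Longrightarrow>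
    fps_nth (prod f I) n = 0"
proof (induction I arbitrary: n rule: finite_induct)
  case (insert i I)
  have "fps_nth (f i * prod f I) n = 0"
    by (rule fps_nth_mult_below[where d = "d i" and e = "sum d I"]) (use insert in auto)
  then show ?case using insert by simp
qed auto

lemma fps_monom_nth_below:
  assumes "\<And>v. fps_nth (P v) 0 = 0" and "n < mps_degree \<alpha>"
  shows "fps_nth (fps_monom P \<alpha>) n = 0"
  unfolding fps_monom_def
proof (rule fps_nth_prod_below[where d = \<alpha>])
  fix v k assume "k < \<alpha> v"
  then show "fps_nth (P v ^ \<alpha> v) k = 0"
    using fps_nth_power_below[of 1 "P v" k "\<alpha> v"] assms(1) by simp
qed (use assms(2) in \<open>simp_all add: mps_degree_def\<close>)

lemma mps_eval_add: "mps_eval P (f + g) = mps_eval P f + mps_eval P g"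
  by (rule fps_ext) (simp add: mps_eval_nth algebra_simps sum.distrib)

lemma mps_eval_diff: "mps_eval P (f - g) = mps_eval P f - mps_eval P g"
  by (rule fps_ext) (simp add: mps_eval_nth algebra_simps sum_subtractf)

lemma mps_eval_const [simp]: "mps_eval P (mps_const c) = fps_const c"
proof (rule fps_ext)
  fix n
  have "fps_nth (mps_eval P (mps_const c)) n =
      (\<Sum>\<alpha>\<in>{0}. mps_coeff (mps_const c) \<alpha> * fps_nth (fps_monom P \<alpha>) n)"
    unfolding mps_eval_nth by (rule sum.mono_neutral_right) (auto simp: finite_mps_degree_le)
  then show "fps_nth (mps_eval P (mps_const c)) n = fps_nth (fps_const c) n"
    by simp
qed

lemma mps_const_0: "mps_const 0 = 0" and mps_const_1: "mps_const 1 = 1"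
  by (rule mps_eqI, simp)+

lemma mps_eval_0 [simp]: "mps_eval P 0 = 0" and mps_eval_1 [simp]: "mps_eval P 1 = 1"
  using mps_eval_const[of P 0] mps_eval_const[of P 1] by (simp_all add: mps_const_0 mps_const_1)

lemma mps_eval_sum: "mps_eval P (sum f I) = (\<Sum>i\<in>I. mps_eval P (f i))"
  by (induction I rule: infinite_finite_induct) (auto simp: mps_eval_add)

text \<open>Raising the cutoff only adds monomials whose order exceeds \<open>n\<close>.
  Coefficients of different index can thereby share one range of summation.\<close>

lemma mps_eval_nth_extend:
  assumes "\<And>v. fps_nth (P v) 0 = 0" and "n \<le> N"
  shows "fps_nth (mps_eval P f) n =
    (\<Sum>\<alpha> | mps_degree \<alpha> \<le> N. mps_coeff f \<alpha> * fps_nth (fps_monom P \<alpha>) n)"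
  unfolding mps_eval_nth
proof (rule sum.mono_neutral_left)
  show "\<forall>\<alpha>\<in>{\<alpha>. mps_degree \<alpha> \<le> N} - {\<alpha>. mps_degree \<alpha> \<le> n}.
      mps_coeff f \<alpha> * fps_nth (fps_monom P \<alpha>) n = 0"
    using fps_monom_nth_below[of P, OF assms(1)] by auto
qed (use assms(2) finite_mps_degree_le in auto)

text \<open>Both sides become a sum over pairs of exponents of degree at most \<open>n\<close>. The
  left side omits the pairs of larger total degree, but their monomials have order above
  \<open>n\<close> and contribute zero.\<close>

lemma mps_eval_mult:
  assumes P: "\<And>v. fps_nth (P v) 0 = 0"
  shows "mps_eval P (f * g) = mps_eval P f * mps_eval P g"
proof (rule fps_ext)
  fix n
  define D where "D = {\<alpha> :: 'a \<Rightarrow> nat. mps_degree \<alpha> \<le> n}"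
  define t where "t = (\<lambda>\<beta> \<gamma>. mps_coeff f \<beta> * mps_coeff g \<gamma> * fps_nth (fps_monom P (\<beta> + \<gamma>)) n)"
  have fin: "finite D"
    by (simp add: D_def finite_mps_degree_le)
  have "fps_nth (mps_eval P (f * g)) n = (\<Sum>\<alpha>\<in>D. \<Sum>(\<beta>, \<gamma>)\<in>antidiag \<alpha>. t \<beta> \<gamma>)"
    unfolding mps_eval_nth D_def t_def
    by (intro sum.cong refl) (auto simp: mps_coeff_mult sum_distrib_right intro!: sum.cong)
  also have "\<dots> = (\<Sum>z\<in>(SIGMA \<alpha>:D. antidiag \<alpha>). t (fst (snd z)) (snd (snd z)))"
    using fin by (simp add: sum.Sigma case_prod_unfold)
  also have "\<dots> = (\<Sum>(\<beta>, \<gamma>)\<in>{z \<in> D \<times> D. fst z + snd z \<in> D}. t \<beta> \<gamma>)"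
    by (rule sum.reindex_bij_witness[where
          i = "\<lambda>z. (fst z + snd z, z)" and j = snd])
      (auto simp: D_def mps_degree_add)
  also have "\<dots> = (\<Sum>(\<beta>, \<gamma>)\<in>D \<times> D. t \<beta> \<gamma>)"
  proof (rule sum.mono_neutral_left)
    have "\<beta> + \<gamma> \<in> D" if "t \<beta> \<gamma> \<noteq> 0" for \<beta> \<gamma>
      using that fps_monom_nth_below[of P n "\<beta> + \<gamma>", OF P] by (force simp: D_def t_def)
    then show "\<forall>z\<in>D \<times> D - {z \<in> D \<times> D. fst z + snd z \<in> D}. (case z of (\<beta>, \<gamma>) \<Rightarrow> t \<beta> \<gamma>) = 0"
      by auto
  qed (use fin in auto)
  also have "\<dots> = (\<Sum>\<beta>\<in>D. \<Sum>\<gamma>\<in>D. t \<beta> \<gamma>)"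
    by (simp add: sum.cartesian_product)
  also have "\<dots> = (\<Sum>\<beta>\<in>D. \<Sum>\<gamma>\<in>D. \<Sum>i = 0..n.
      (mps_coeff f \<beta> * fps_nth (fps_monom P \<beta>) i) * (mps_coeff g \<gamma> * fps_nth (fps_monom P \<gamma>) (n - i)))"
    unfolding t_def
    by (intro sum.cong refl) (simp add: fps_monom_add fps_mult_nth sum_distrib_left mult_ac)
  also have "\<dots> = (\<Sum>i = 0..n. \<Sum>\<beta>\<in>D. \<Sum>\<gamma>\<in>D.
      (mps_coeff f \<beta> * fps_nth (fps_monom P \<beta>) i) * (mps_coeff g \<gamma> * fps_nth (fps_monom P \<gamma>) (n - i)))"
    by (simp only: sum.swap[where B = "{0..n}" and A = D])
  also have "\<dots> = (\<Sum>i = 0..n. fps_nth (mps_eval P f) i * fps_nth (mps_eval P g) (n - i))"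
    unfolding sum_product[symmetric] D_def
    by (intro sum.cong refl) (simp add: mps_eval_nth_extend[OF P, where N = n])
  finally show "fps_nth (mps_eval P (f * g)) n = fps_nth (mps_eval P f * mps_eval P g) n"
    by (simp add: fps_mult_nth)
qed

lemma mps_eval_power:
  assumes P: "\<And>v. fps_nth (P v) 0 = 0"
  shows "mps_eval P (f ^ n) = mps_eval P f ^ n"
  by (induction n) (simp_all add: mps_eval_mult[of P, OF P])

lemma mps_eval_prod:
  assumes P: "\<And>v. fps_nth (P v) 0 = 0"
  shows "mps_eval P (prod f I) = (\<Prod>i\<in>I. mps_eval P (f i))"
  by (induction I rule: infinite_finite_induct) (simp_all add: mps_eval_mult[of P, OF P])

lemma mps_eval_nth_0: "fps_nth (mps_eval P f) 0 = mps_coeff f 0"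
  by (simp add: mps_eval_nth)

section \<open>Convergent infinite sums and substitution\<close>

lemma mps_coeff_mps_sum:
  assumes "\<And>i. mps_vanish (d i) (F i)" and "finite {i. d i \<le> n}" and "mps_degree \<alpha> \<le> n"
  shows "mps_coeff (mps_sum F) \<alpha> = (\<Sum>i | d i \<le> n. mps_coeff (F i) \<alpha>)"
  unfolding mps_sum_def mps_coeff_Abs
proof (rule Sum_any.expand_superset[OF assms(2)])
  \<comment> \<open>A member with \<open>d i > n\<close> vanishes in all degrees up to
    \<open>n\<close>, so only the finitely many remaining ones reach
    \<open>\<alpha>\<close>.\<close>
  show "{i. mps_coeff (F i) \<alpha> \<noteq> 0} \<subseteq> {i. d i \<le> n}"
    using assms(1,3) by (force simp: mps_vanish_def)
qed

lemma mps_eval_mps_sum: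
  assumes "\<And>i. mps_vanish (d i) (F i)" and "finite {i. d i \<le> n}"
  shows "fps_nth (mps_eval P (mps_sum F)) n = (\<Sum>i | d i \<le> n. fps_nth (mps_eval P (F i)) n)"
proof -
  have "fps_nth (mps_eval P (mps_sum F)) n = (\<Sum>\<alpha> | mps_degree \<alpha> \<le> n. \<Sum>i | d i \<le> n.
      mps_coeff (F i) \<alpha> * fps_nth (fps_monom P \<alpha>) n)"
    unfolding mps_eval_nth
    by (intro sum.cong refl) (simp add: mps_coeff_mps_sum[OF assms] sum_distrib_right)
  also have "\<dots> = (\<Sum>i | d i \<le> n. fps_nth (mps_eval P (F i)) n)"
    unfolding mps_eval_nth by (rule sum.swap)
  finally show ?thesis .
qed

definition mps_map :: "('a \<Rightarrow> 'a) \<Rightarrow> ('v, 'a) mps \<Rightarrow> ('v, 'a) mps"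
  where "mps_map \<sigma> f = Abs_mps (\<lambda>\<alpha>. \<sigma> (mps_coeff f \<alpha>))"

text \<open>Since each \<open>F v\<close> lacks a constant term, the summand of exponent
  \<open>\<alpha>\<close> has order at least the degree of \<open>\<alpha>\<close>, so evaluation
  passes through the infinite sum. Substitution becomes composition of points, and
  \<open>\<sigma>\<close> stays behind on the coefficients.\<close>

lemma mps_eval_subst:
  assumes P: "\<And>v. fps_nth (P v) 0 = 0" and F: "\<And>v. mps_coeff (F v) 0 = 0"
  shows "mps_eval P (mps_subst \<sigma> F f) = mps_eval (\<lambda>v. mps_eval P (F v)) (mps_map \<sigma> f)"
proof (rule fps_ext)
  fix n
  have "mps_vanish (mps_degree \<alpha>) (mps_const c * (\<Prod>v\<in>UNIV. F v ^ \<alpha> v))" for \<alpha> c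
  proof -
    have "mps_vanish (1 * \<alpha> v) (F v ^ \<alpha> v)" for v
      by (intro mps_vanish_power) (simp add: mps_vanish_Suc_0 F)
    then have "mps_vanish (0 + sum \<alpha> UNIV) (mps_const c * (\<Prod>v\<in>UNIV. F v ^ \<alpha> v))"
      by (intro mps_vanish_mult mps_vanish_prod) auto
    then show ?thesis
      by (simp add: mps_degree_def)
  qed
  note * = mps_eval_mps_sum[OF this finite_mps_degree_le]
  show "fps_nth (mps_eval P (mps_subst \<sigma> F f)) n =
      fps_nth (mps_eval (\<lambda>v. mps_eval P (F v)) (mps_map \<sigma> f)) n"
    unfolding mps_subst_def *
    by (simp add: mps_eval_nth[of "\<lambda>v. mps_eval P (F v)"] mps_map_def mps_eval_mult[OF P]
        mps_eval_prod[OF P] mps_eval_power[OF P] fps_monom_def)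
qed

lemma mps_eval_var:
  assumes P: "\<And>v. fps_nth (P v) 0 = 0"
  shows "mps_eval P (mps_var v) = P v"
proof (rule fps_ext)
  fix n
  let ?e = "\<lambda>w. if w = v then 1 else 0 :: nat"
  have 1: "mps_degree ?e = 1"
    by (simp add: mps_degree_def)
  have 2: "fps_monom P ?e = P v"
    by (simp add: fps_monom_def if_distrib[of "\<lambda>k. _ ^ k"] cong: if_cong)
  \<comment> \<open>The cutoff \<open>max 1 n\<close> keeps the exponent of \<open>v\<close>, of
    degree 1, in range also for \<open>n = 0\<close>.\<close>
  have "fps_nth (mps_eval P (mps_var v)) n =
      (\<Sum>\<alpha> | mps_degree \<alpha> \<le> max 1 n. mps_coeff (mps_var v) \<alpha> * fps_nth (fps_monom P \<alpha>) n)"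
    by (rule mps_eval_nth_extend[OF P]) simp
  also have "\<dots> = (\<Sum>\<alpha>\<in>{?e}. mps_coeff (mps_var v) \<alpha> * fps_nth (fps_monom P \<alpha>) n)"
    by (rule sum.mono_neutral_right) (use 1 in \<open>simp_all add: finite_mps_degree_le mps_var_def\<close>)
  finally show "fps_nth (mps_eval P (mps_var v)) n = fps_nth (P v) n"
    using 2 by (simp add: mps_var_def)
qed

text \<open>The condition \<open>\<sigma> 0 = 0\<close> kills every term but the one of the exponent
  of \<open>v\<close>, whose coefficient stays 1 by \<open>\<sigma> 1 = 1\<close>.\<close>

lemma mps_subst_var:
  assumes "\<sigma> 0 = 0" "\<sigma> 1 = 1"
  shows "mps_subst \<sigma> F (mps_var v) = F v"
proof (rule mps_eqI)
  fix \<alpha>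
  let ?e = "\<lambda>w. if w = v then 1 else 0 :: nat"
  let ?t = "\<lambda>\<beta>. mps_coeff (mps_const (\<sigma> (mps_coeff (mps_var v) \<beta>)) * (\<Prod>w\<in>UNIV. F w ^ \<beta> w)) \<alpha>"
  have "mps_coeff (mps_subst \<sigma> F (mps_var v)) \<alpha> = Sum_any ?t"
    by (simp only: mps_subst_def mps_sum_def mps_coeff_Abs)
  also have "\<dots> = sum ?t {?e}"
    by (rule Sum_any.expand_superset) (auto simp: mps_var_def assms mps_const_0 split: if_splits)
  also have "\<dots> = mps_coeff (F v) \<alpha>"
    by (simp add: mps_var_def assms mps_const_1 if_distrib[of "\<lambda>k. _ ^ k"] cong: if_cong)
  finally show "mps_coeff (mps_subst \<sigma> F (mps_var v)) \<alpha> = mps_coeff (F v) \<alpha>" .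
qed

section \<open>Matrices of power series\<close>

lemma matrix_mult_nth: "(A ** B) $ i $ j = (\<Sum>k\<in>UNIV. A $ i $ k * B $ k $ j)"
  by (simp add: matrix_matrix_mult_def)

lemma mat_nth: "mat c $ i $ j = (if i = j then c else 0)"
  by (simp add: mat_def)

lemma transpose_nth: "transpose A $ i $ j = A $ j $ i"
  by (simp add: transpose_def)

lemma entry_power_nth: "entry_power A p $ i $ j = (A $ i $ j) ^ p"
  by (simp add: entry_power_def)

lemma matrix_eqI: "(\<And>i j. A $ i $ j = B $ i $ j) \<Longrightarrow> A = B"
  by (simp add: vec_eq_iff)

lemma matrix_diff_ldistrib:
  fixes A :: "'a::ring_1 ^ 'n ^ 'm"
  shows "A ** (B - C) = A ** B - A ** C"
  by (rule matrix_eqI) (simp add: matrix_mult_nth right_diff_distrib sum_subtractf)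

lemma matrix_diff_rdistrib:
  fixes A :: "'a::ring_1 ^ 'n ^ 'm"
  shows "(A - B) ** C = A ** C - B ** C"
  by (rule matrix_eqI) (simp add: matrix_mult_nth left_diff_distrib sum_subtractf)

lemma matrix_add_rdistrib:
  fixes A :: "'a::ring_1 ^ 'n ^ 'm"
  shows "(A + B) ** C = A ** C + B ** C"
  by (rule matrix_eqI) (simp add: matrix_mult_nth distrib_right sum.distrib)

text \<open>Stated for any map preserving 0, sums and products, so that it serves both for taking
  constant terms and for evaluating along a curve.\<close>

lemma map_matrix_mult:
  assumes "f 0 = 0" "\<And>x y. f (x + y) = f x + f y" "\<And>x y. f (x * y) = f x * f y"
  shows "map_matrix f (A ** B) = map_matrix f A ** map_matrix f B"
proof -
  have "f (sum g K) = (\<Sum>k\<in>K. f (g k))" for g :: "'e::finite \<Rightarrow> _" and K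
    by (induction K rule: infinite_finite_induct) (simp_all add: assms)
  then show ?thesis
    by (intro matrix_eqI) (simp add: matrix_mult_nth assms)
qed

section \<open>Powers of a matrix and the geometric series\<close>

lemma mat_power_0 [simp]: "mat_power V 0 = mat 1"
  and mat_power_Suc: "mat_power V (Suc k) = V ** mat_power V k"
  by (simp_all add: mat_power_def)

lemma mat_power_Suc_right: "mat_power V (Suc k) = mat_power V k ** V"
  by (induction k) (simp_all add: mat_power_Suc matrix_mul_assoc)

lemma mat_power_telescope:
  fixes V :: "'a::ring_1 ^ 'n ^ 'n"
  shows "(mat 1 - V) ** (\<Sum>k\<le>n. mat_power V k) = mat 1 - mat_power V (Suc n)"
  by (induction n)
    (simp_all add: matrix_add_ldistrib matrix_diff_rdistrib mat_power_Suc)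

lemma mat_power_commute_sum:
  fixes V :: "'a::ring_1 ^ 'n ^ 'n"
  shows "(\<Sum>k\<le>n. mat_power V k) ** (mat 1 - V) = (mat 1 - V) ** (\<Sum>k\<le>n. mat_power V k)"
  by (induction n)
    (simp_all add: matrix_add_ldistrib matrix_add_rdistrib matrix_diff_rdistrib matrix_diff_ldistrib
      flip: mat_power_Suc mat_power_Suc_right)

lemma mps_vanish_mat_power:
  assumes "\<And>i j. mps_coeff (V $ i $ j) 0 = 0"
  shows "mps_vanish k (mat_power V k $ i $ j)"
proof (induction k arbitrary: i j)
  case (Suc k)
  have "mps_vanish (1 + k) (V $ i $ l * mat_power V k $ l $ j)" for l
    by (rule mps_vanish_mult) (use assms Suc in \<open>auto simp: mps_vanish_Suc_0\<close>)
  then show ?case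
    by (auto simp: mat_power_Suc matrix_mult_nth intro: mps_vanish_sum)
qed simp

subsection \<open>Coefficients in a subring\<close>

text \<open>A plain set, so that one notion covers \<open>A\<close>, its part fixed by a Frobenius
  lift, and the power series over either.\<close>

definition unital_subring :: "'a::comm_ring_1 set \<Rightarrow> bool"
  where "unital_subring R \<longleftrightarrow> 1 \<in> R \<and> (\<forall>x\<in>R. \<forall>y\<in>R. x - y \<in> R \<and> x * y \<in> R)"

definition mps_over :: "'a set \<Rightarrow> ('v, 'a) mps set"
  where "mps_over R = {f. \<forall>\<alpha>. mps_coeff f \<alpha> \<in> R}"

definition mat_over :: "'a set \<Rightarrow> ('a ^ 'n ^ 'm) set"
  where "mat_over R = {A. \<forall>i j. A $ i $ j \<in> R}"

lemma unital_subring_closed: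
  assumes "unital_subring R"
  shows "0 \<in> R" "1 \<in> R" "x \<in> R \<Longrightarrow> - x \<in> R" "x \<in> R \<Longrightarrow> y \<in> R \<Longrightarrow> x - y \<in> R"
    "x \<in> R \<Longrightarrow> y \<in> R \<Longrightarrow> x + y \<in> R" "x \<in> R \<Longrightarrow> y \<in> R \<Longrightarrow> x * y \<in> R"
proof -
  show 0: "0 \<in> R"
    using assms unfolding unital_subring_def by (metis diff_self)
  show neg: "- x \<in> R" if "x \<in> R" for x
    using assms 0 that unfolding unital_subring_def by (metis diff_0)
  show "x + y \<in> R" if "x \<in> R" "y \<in> R"
    using assms neg that unfolding unital_subring_def by (metis diff_minus_eq_add)
qed (use assms in \<open>auto simp: unital_subring_def\<close>)

lemma unital_subring_sum:
  "unital_subring R \<Longrightarrow> (\<And>i. i \<in> I \<Longrightarrow> f i \<in> R) \<Longrightarrow> sum f I \<in> R"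
  by (induction I rule: infinite_finite_induct) (auto intro: unital_subring_closed)

lemma unital_subring_power: "unital_subring R \<Longrightarrow> x \<in> R \<Longrightarrow> x ^ n \<in> R"
  by (induction n) (auto intro: unital_subring_closed)

lemma unital_subring_of_nat: "unital_subring R \<Longrightarrow> of_nat n \<in> R"
  by (induction n) (auto intro: unital_subring_closed)

lemma unital_subring_mps_over:
  fixes R :: "'a::comm_ring_1 set"
  assumes "unital_subring R"
  shows "unital_subring (mps_over R :: ('v::finite, 'a) mps set)"
  unfolding unital_subring_def
proof (intro conjI ballI)
  show "(1 :: ('v, 'a) mps) \<in> mps_over R"
    using assms by (simp add: mps_over_def unital_subring_closed)
  fix f g :: "('v, 'a) mps"
  assume "f \<in> mps_over R" "g \<in> mps_over R"
  then show "f - g \<in> mps_over R" "f * g \<in> mps_over R"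
    using assms by (auto simp: mps_over_def mps_coeff_mult
        intro!: unital_subring_sum unital_subring_closed(4,6))
qed

lemma mps_over_const: "unital_subring R \<Longrightarrow> c \<in> R \<Longrightarrow> mps_const c \<in> mps_over R"
  by (auto simp: mps_over_def mps_const_def intro: unital_subring_closed)

lemma mps_over_var: "unital_subring R \<Longrightarrow> mps_var v \<in> mps_over R"
  by (auto simp: mps_over_def mps_var_def intro: unital_subring_closed)

lemma mps_over_mps_sum:
  assumes "unital_subring R" "\<And>i. F i \<in> mps_over R"
  shows "mps_sum F \<in> mps_over R"
  using assms by (auto simp: mps_over_def mps_sum_def Sum_any.expand_set intro: unital_subring_sum)

lemma mat_over_nth: "A \<in> mat_over R \<Longrightarrow> A $ i $ j \<in> R"
  by (simp add: mat_over_def)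

lemma mat_over_mult: "unital_subring R \<Longrightarrow> A \<in> mat_over R \<Longrightarrow> B \<in> mat_over R \<Longrightarrow> A ** B \<in> mat_over R"
  by (auto simp: mat_over_def matrix_mult_nth intro!: unital_subring_sum unital_subring_closed(6))

lemma mat_over_diff: "unital_subring R \<Longrightarrow> A \<in> mat_over R \<Longrightarrow> B \<in> mat_over R \<Longrightarrow> A - B \<in> mat_over R"
  by (auto simp: mat_over_def intro: unital_subring_closed)

lemma mat_over_1: "unital_subring R \<Longrightarrow> mat 1 \<in> mat_over R"
  by (auto simp: mat_over_def mat_nth intro: unital_subring_closed)

lemma mat_over_transpose: "A \<in> mat_over R \<Longrightarrow> transpose A \<in> mat_over R"
  by (simp add: mat_over_def transpose_nth)

lemma mat_over_entry_power: "unital_subring R \<Longrightarrow> A \<in> mat_over R \<Longrightarrow> entry_power A p \<in> mat_over R"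
  by (simp add: mat_over_def entry_power_nth unital_subring_power)

lemma mat_over_mat_power: "unital_subring R \<Longrightarrow> A \<in> mat_over R \<Longrightarrow> mat_power A k \<in> mat_over R"
  by (induction k) (simp_all add: mat_over_1 mat_power_Suc mat_over_mult)

text \<open>Vandermonde's identity with \<open>1/2 + 1/2 = 1\<close> expresses \<open>2 * (1/2 gchoose k)\<close> through the
  preceding binomial coefficients.\<close>

lemma gbinomial_half_in_subring:
  fixes R :: "complex set"
  assumes R: "unital_subring R" and half: "1/2 \<in> R"
  shows "(1/2) gchoose k \<in> R"
proof (induction k rule: less_induct)
  case (less k)
  let ?b = "\<lambda>i. ((1/2) gchoose i :: complex)"
  show ?case
  proof (cases "k = 0")
    case True
    then show ?thesis by (simp add: unital_subring_closed R)
  next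
    case False
    have "(\<Sum>i = 0..k. ?b i * ?b (k - i)) = (1 gchoose k)"
      using gbinomial_Vandermonde[of "1/2 :: complex" "1/2" k] by simp
    \<comment> \<open>The two end terms are distinct because \<open>k\<close> is nonzero, and each
      equals \<open>?b k\<close>; together they give the \<open>2 * ?b k\<close>.\<close>
    moreover have "{0..k} = insert 0 (insert k {0<..<k})"
      using False by auto
    moreover have halve: "2 * b + s = c \<Longrightarrow> b = 1/2 * (c - s)" for b c s :: complex
      by auto
    ultimately have "2 * ?b k + (\<Sum>i\<in>{0<..<k}. ?b i * ?b (k - i)) = of_nat (1 choose k)"
      using False by (simp add: binomial_gbinomial)
    then have eq: "?b k = 1/2 * (of_nat (1 choose k) - (\<Sum>i\<in>{0<..<k}. ?b i * ?b (k - i)))"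
      using halve by blast
    have "(\<Sum>i\<in>{0<..<k}. ?b i * ?b (k - i)) \<in> R"
      by (rule unital_subring_sum[OF R]) (auto intro!: unital_subring_closed R less)
    then show ?thesis
      by (subst eq, intro unital_subring_closed(4,6)[OF R] half unital_subring_of_nat[OF R])
  qed
qed

subsection \<open>Inverses\<close>

text \<open>Such a matrix is 1 - \<open>V\<close> with \<open>V\<close> in the ideal of the
  variables, and the geometric series in \<open>V\<close> converges to a two-sided inverse. Being
  built from powers of \<open>V\<close>, the inverse keeps its coefficients in every subring that
  contains those of \<open>A\<close>.\<close>

lemma mps_matrix_inverse:
  fixes A :: "('v::finite, 'a::comm_ring_1) mps ^ 'n ^ 'n"
  assumes A: "map_matrix (\<lambda>f. mps_coeff f 0) A = mat 1"
  shows "A ** matrix_inv A = mat 1" "matrix_inv A ** A = mat 1"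
    and "unital_subring R \<Longrightarrow> A \<in> mat_over (mps_over R) \<Longrightarrow> matrix_inv A \<in> mat_over (mps_over R)"
proof -
  define V where "V = mat 1 - A"
  define S where "S = (\<chi> i j. mps_sum (\<lambda>k. mat_power V k $ i $ j))"
  have V0: "mps_coeff (V $ i $ j) 0 = 0" for i j
    using arg_cong[OF A, of "\<lambda>B. B $ i $ j"] by (auto simp: V_def mat_nth)
  note van = mps_vanish_mat_power[of V, OF V0]
  have close: "mps_vanish (Suc n) ((S - (\<Sum>k\<le>n. mat_power V k)) $ i $ j)" for n i j
    unfolding mps_vanish_def
  proof (intro allI impI)
    fix \<alpha> :: "'v \<Rightarrow> nat"
    assume "mps_degree \<alpha> < Suc n"
    moreover have "{k. k \<le> n} = {..n}"
      by auto
    ultimately show "mps_coeff ((S - (\<Sum>k\<le>n. mat_power V k)) $ i $ j) \<alpha> = 0"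
      using mps_coeff_mps_sum[of "\<lambda>k. k" "\<lambda>k. mat_power V k $ i $ j" n \<alpha>, OF van]
      by (simp add: S_def mps_coeff_sum)
  qed
  have A_eq: "A = mat 1 - V"
    by (simp add: V_def)
  \<comment> \<open>At a given \<open>\<alpha>\<close> only finitely many degrees matter: up to the
    degree of \<open>\<alpha>\<close>, the telescoping remainder, a power of \<open>V\<close> one
    higher, vanishes as well.\<close>
  have coeff_eq: "mps_coeff (B $ i $ j) \<alpha> = mps_coeff (mat 1 $ i $ j) \<alpha>"
    if "\<And>i j. mps_vanish (Suc (mps_degree \<alpha>)) ((B - (mat 1 - mat_power V (Suc (mps_degree \<alpha>)))) $ i $ j)"
    for B :: "('v, 'a) mps ^ 'n ^ 'n" and i j \<alpha>
  proof -
    have "mps_coeff ((B - (mat 1 - mat_power V (Suc (mps_degree \<alpha>)))) $ i $ j) \<alpha> = 0"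
      "mps_coeff (mat_power V (Suc (mps_degree \<alpha>)) $ i $ j) \<alpha> = 0"
      using that van[of "Suc (mps_degree \<alpha>)"] unfolding mps_vanish_def by blast+
    then show ?thesis by simp
  qed
  have AS: "A ** S = mat 1"
  proof (intro matrix_eqI mps_eqI coeff_eq)
    fix n i j
    have "A ** S - (mat 1 - mat_power V (Suc n)) = A ** (S - (\<Sum>k\<le>n. mat_power V k))"
      unfolding A_eq matrix_diff_ldistrib mat_power_telescope by simp
    moreover have "mps_vanish (0 + Suc n) (A $ i $ k * (S - (\<Sum>k\<le>n. mat_power V k)) $ k $ j)" for k
      using close by (intro mps_vanish_mult) auto
    ultimately show "mps_vanish (Suc n) ((A ** S - (mat 1 - mat_power V (Suc n))) $ i $ j)"
      by (simp add: matrix_mult_nth mps_vanish_sum)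
  qed
  have SA: "S ** A = mat 1"
  proof (intro matrix_eqI mps_eqI coeff_eq)
    fix n i j
    have "S ** A - (mat 1 - mat_power V (Suc n)) = (S - (\<Sum>k\<le>n. mat_power V k)) ** A"
      unfolding A_eq matrix_diff_rdistrib[of S] mat_power_commute_sum mat_power_telescope by simp
    moreover have "mps_vanish (Suc n + 0) ((S - (\<Sum>k\<le>n. mat_power V k)) $ i $ k * A $ k $ j)" for k
      using close by (intro mps_vanish_mult) auto
    ultimately show "mps_vanish (Suc n) ((S ** A - (mat 1 - mat_power V (Suc n))) $ i $ j)"
      by (simp add: matrix_mult_nth mps_vanish_sum)
  qed
  show inv1: "A ** matrix_inv A = mat 1" and inv2: "matrix_inv A ** A = mat 1"
    using someI[of "\<lambda>B. A ** B = mat 1 \<and> B ** A = mat 1" S] AS SA by (simp_all add: matrix_inv_def)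
  \<comment> \<open>\<open>matrix_inv\<close> is only a choice; uniqueness of inverses identifies it
    with the explicit series, whose coefficients are under control.\<close>
  have "matrix_inv A = S"
    using inv2 AS by (metis matrix_mul_assoc matrix_mul_lid matrix_mul_rid)
  then show "matrix_inv A \<in> mat_over (mps_over R)"
    if "unital_subring R" "A \<in> mat_over (mps_over R)"
    using that unital_subring_mps_over[OF that(1), where 'v = 'v]
    by (auto simp: S_def mat_over_def[of _, where 'n='n] V_def intro!: mps_over_mps_sum
        mat_over_nth[OF mat_over_mat_power] mat_over_diff mat_over_1)
qed

section \<open>Second-order expansion of the Chern lift\<close>

text \<open>Reduction modulo the variables, that is, the value at x = 1. It decides which matrices
  can be inverted or inserted into the binomial series.\<close>

definition const_part :: "('v::finite, 'a::comm_ring_1) mps ^ 'n ^ 'm \<Rightarrow> 'a ^ 'n ^ 'm"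
  where "const_part = map_matrix (\<lambda>f. mps_coeff f 0)"

lemma const_part_nth: "const_part A $ i $ j = mps_coeff (A $ i $ j) 0"
  by (simp add: const_part_def)

lemma const_part_mult: "const_part (A ** B) = const_part A ** const_part B"
  unfolding const_part_def by (rule map_matrix_mult) simp_all

lemma mps_coeff_power_0: "mps_coeff (f ^ n) 0 = mps_coeff f 0 ^ n"
  by (induction n) (simp_all del: zero_fun_apply)

lemma const_part_entry_power: "const_part (entry_power A p) = entry_power (const_part A) p"
  by (rule matrix_eqI) (simp add: const_part_nth entry_power_nth mps_coeff_power_0)

lemma const_part_transpose: "const_part (transpose A) = transpose (const_part A)"
  by (rule matrix_eqI) (simp add: const_part_nth transpose_nth)

lemma const_part_1 [simp]: "const_part (mat 1) = mat 1"
  by (rule matrix_eqI) (simp add: const_part_nth mat_nth)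

lemma entry_power_1 [simp]: "p > 0 \<Longrightarrow> entry_power (mat 1 :: 'a::comm_ring_1 ^ 'n ^ 'n) p = mat 1"
  by (rule matrix_eqI) (simp add: entry_power_nth mat_nth zero_power)

lemma const_part_x_mat [simp]: "const_part x_mat = mat 1"
  by (rule matrix_eqI) (simp add: const_part_nth x_mat_def mat_nth mps_var_def fun_eq_iff)

lemma const_part_matrix_inv: "const_part A = mat 1 \<Longrightarrow> const_part (matrix_inv A) = mat 1"
  using const_part_mult[of "matrix_inv A" A] mps_matrix_inverse(2)[of A]
  by (simp add: const_part_def[symmetric])

lemma mps_vanish_binomial_term:
  assumes "const_part U = 0"
  shows "mps_vanish k (mps_const c * mat_power U k $ i $ j)"
proof -
  have "mps_coeff (U $ i $ j) 0 = 0" for i j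
    using assms const_part_nth[of U i j] by simp
  then show ?thesis
    using mps_vanish_mult[of 0 "mps_const c"] mps_vanish_mat_power[of U] by fastforce
qed

lemma const_part_mat_binomial_sqrt:
  assumes "const_part U = 0"
  shows "const_part (mat_binomial_sqrt U) = mat 1"
proof (rule matrix_eqI)
  fix i j
  have "mps_coeff (mat_binomial_sqrt U $ i $ j) 0 =
      (\<Sum>k | k \<le> 0. mps_coeff (mps_const ((1/2) gchoose k) * mat_power U k $ i $ j) 0)"
    unfolding mat_binomial_sqrt_def vec_lambda_beta
    by (rule mps_coeff_mps_sum[OF mps_vanish_binomial_term[OF assms]]) auto
  then show "const_part (mat_binomial_sqrt U) $ i $ j = mat 1 $ i $ j"
    by (simp add: const_part_nth mat_nth)
qed

section \<open>The matrix under the square root and the coefficients of the Chern lift\<close>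

definition chern_arg :: "nat \<Rightarrow> ('n \<times> 'n, complex) mps ^ 'n ^ 'n::finite"
  where "chern_arg p = matrix_inv (transpose (entry_power x_mat p) ** entry_power x_mat p) **
    entry_power (transpose x_mat ** x_mat) p"

lemma chern_image_eq: "chern_image p = entry_power x_mat p ** mat_binomial_sqrt (chern_arg p - mat 1)"
  by (simp add: chern_image_def chern_arg_def Let_def)

lemma const_part_gram:
  "p > 0 \<Longrightarrow> const_part (transpose (entry_power x_mat p) ** entry_power x_mat p) = mat 1"
  by (simp add: const_part_mult const_part_transpose const_part_entry_power)

lemma const_part_chern_arg:
  assumes p: "p > 0"
  shows "const_part (chern_arg p - mat 1 :: ('n::finite \<times> 'n, complex) mps ^ 'n ^ 'n) = 0"
proof -
  have "const_part (chern_arg p :: ('n \<times> 'n, complex) mps ^ 'n ^ 'n) = mat 1"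
    by (simp add: chern_arg_def const_part_mult const_part_transpose const_part_entry_power p
        const_part_matrix_inv[OF const_part_gram[OF p]])
  then show ?thesis
    by (simp add: vec_eq_iff const_part_nth mat_nth)
qed

lemma const_part_chern_image: "p > 0 \<Longrightarrow> const_part (chern_image p) = mat 1"
  by (simp add: chern_image_eq const_part_mult const_part_entry_power
      const_part_mat_binomial_sqrt[OF const_part_chern_arg])

lemma x_mat_over: "unital_subring R \<Longrightarrow> x_mat \<in> mat_over (mps_over R)"
  by (auto simp: mat_over_def x_mat_def mat_nth
      intro!: unital_subring_closed mps_over_var unital_subring_mps_over)

text \<open>Inverse and binomial series introduce no denominators other than powers of 2. Used with
  the subring of \<open>A\<close> fixed by a Frobenius lift, on which the lift's action on
  coefficients disappears.\<close>

lemma chern_image_over: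
  assumes R: "unital_subring R" and half: "1/2 \<in> R" and p: "p > 0"
  shows "chern_image p \<in> mat_over (mps_over R)"
proof -
  note S = unital_subring_mps_over[OF R]
  have xp: "entry_power x_mat p \<in> mat_over (mps_over R)"
    by (intro mat_over_entry_power S x_mat_over R)
  have "const_part (transpose (entry_power x_mat p) ** entry_power x_mat p) = mat 1"
    by (rule const_part_gram[OF p])
  then have "chern_arg p \<in> mat_over (mps_over R)"
    unfolding chern_arg_def const_part_def
    by (intro mat_over_mult mps_matrix_inverse(3) mat_over_transpose mat_over_entry_power
        S x_mat_over R)
  then have "mat_power (chern_arg p - mat 1) k \<in> mat_over (mps_over R)" for k
    by (intro mat_over_mat_power mat_over_diff mat_over_1 S)
  then have "mat_binomial_sqrt (chern_arg p - mat 1) \<in> mat_over (mps_over R)"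
    unfolding mat_over_def[of "mps_over R"] mat_binomial_sqrt_def
    by (auto intro!: mps_over_mps_sum R unital_subring_closed(6)[OF S] mps_over_const
        gbinomial_half_in_subring half simp: mat_over_def)
  then show ?thesis
    unfolding chern_image_eq by (intro mat_over_mult S xp)
qed

subsection \<open>Two-jets\<close>

text \<open>The matrix is 1 + t^2 diag(\<open>d\<close>) modulo t^3. Products of such matrices add
  the diagonals, so inverses and square roots become linear operations on \<open>d\<close>.\<close>

definition two_jet :: "complex fps ^ 'n ^ 'n \<Rightarrow> ('n \<Rightarrow> complex) \<Rightarrow> bool"
  where "two_jet A d \<longleftrightarrow> (\<forall>i j. fps_nth (A $ i $ j) 0 = (if i = j then 1 else 0) \<and>
    fps_nth (A $ i $ j) 1 = 0 \<and> fps_nth (A $ i $ j) 2 = (if i = j then d i else 0))"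

lemma fps_mult_nth_2:
  "fps_nth (f * g) 2 = fps_nth f 0 * fps_nth g 2 + fps_nth f 1 * fps_nth g 1 + fps_nth f 2 * fps_nth g 0"
proof -
  have "{0..2::nat} = {0, 1, 2}" by auto
  then show ?thesis by (simp add: fps_mult_nth add.assoc)
qed

lemma fps_nth_power_second_order:
  fixes f :: "'a::comm_ring_1 fps"
  assumes "fps_nth f 0 = 1" "fps_nth f 1 = 0"
  shows "fps_nth (f ^ n) 0 = 1" "fps_nth (f ^ n) 1 = 0" "fps_nth (f ^ n) 2 = of_nat n * fps_nth f 2"
  by (induction n) (use assms in \<open>simp_all add: fps_mult_nth_2 fps_mult_nth_1 algebra_simps\<close>)

lemma two_jet_mult:
  assumes "two_jet A d" "two_jet B e"
  shows "two_jet (A ** B) (\<lambda>i. d i + e i)"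
  using assms
  by (simp add: two_jet_def matrix_mult_nth fps_sum_nth fps_mult_nth_1 fps_mult_nth_2
      sum.distrib if_distrib[of "\<lambda>c. c * _"] if_distrib[of "\<lambda>c. _ * c"] cong: if_cong)

text \<open>The coefficients of \<open>B\<close> are read off from the product in degrees 0, 1, 2 in
  turn, each degree using the previous ones.\<close>

lemma two_jet_left_inverse:
  assumes A: "two_jet A d" and BA: "B ** A = mat 1"
  shows "two_jet B (\<lambda>i. - d i)"
proof -
  have *: "fps_nth ((B ** A) $ i $ j) n = fps_nth (mat 1 $ i $ j) n" for i j n
    by (simp add: BA)
  have 0: "fps_nth (B $ i $ j) 0 = (if i = j then 1 else 0)" for i j
    using *[of i j 0] A
    by (simp add: two_jet_def matrix_mult_nth fps_sum_nth mat_nth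
        if_distrib[of "\<lambda>c. _ * c"] cong: if_cong split: if_splits)
  have 1: "fps_nth (B $ i $ j) 1 = 0" for i j
    using *[of i j 1] A 0
    by (simp add: two_jet_def matrix_mult_nth fps_sum_nth mat_nth fps_mult_nth_1
        if_distrib[of "\<lambda>c. _ * c"] cong: if_cong split: if_splits)
  have 2: "fps_nth (B $ i $ j) 2 = (if i = j then - d i else 0)" for i j
    using *[of i j 2] A 0 1
    by (simp add: two_jet_def matrix_mult_nth fps_sum_nth mat_nth fps_mult_nth_2 sum.distrib
        if_distrib[of "\<lambda>c. _ * c"] if_distrib[of "\<lambda>c. c * _"] add_eq_0_iff
        cong: if_cong split: if_splits)
  show ?thesis
    using 0 1 2 by (simp add: two_jet_def)
qed

text \<open>An off-diagonal entry has order at least 1, so its \<open>p\<close>-th power has order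
  at least 3 and leaves the two-jet; this is where \<open>p \<ge> 3\<close> enters. On the diagonal,
  (1 + a t^2)^p is 1 + p a t^2 modulo t^3.\<close>

lemma two_jet_entry_power:
  assumes p: "p \<ge> 3"
    and 0: "\<And>i j. fps_nth (A $ i $ j) 0 = (if i = j then 1 else 0)"
    and 1: "\<And>i. fps_nth (A $ i $ i) 1 = 0"
  shows "two_jet (entry_power A p) (\<lambda>i. of_nat p * fps_nth (A $ i $ i) 2)"
proof -
  have "fps_nth ((A $ i $ j) ^ p) n = 0" if "i \<noteq> j" "n < 3" for i j n
    using fps_nth_power_below[of 1 "A $ i $ j" n p] 0[of i j] that p by simp
  then show ?thesis
    using fps_nth_power_second_order[OF 0[of i i for i, simplified] 1]
    by (auto simp: two_jet_def entry_power_nth)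
qed

lemma two_jet_transpose: "two_jet A d \<Longrightarrow> two_jet (transpose A) d"
  by (auto simp: two_jet_def transpose_nth)

text \<open>Along the curve \<open>U\<close> has order at least 2 in t, so its square does not reach
  t^2 and the binomial series reduces to 1 + \<open>U\<close>/2.\<close>

lemma two_jet_mat_binomial_sqrt:
  assumes P: "\<And>v. fps_nth (P v) 0 = 0" and U: "const_part U = 0"
    and jet: "two_jet (map_matrix (mps_eval P) (U + mat 1)) d"
  shows "two_jet (map_matrix (mps_eval P) (mat_binomial_sqrt U)) (\<lambda>i. d i / 2)"
proof -
  let ?e = "mps_eval P"
  have e_mat: "?e (mat 1 $ i $ j) = mat 1 $ i $ j" for i j
    by (simp add: mat_nth)
  have low: "fps_nth (?e (U $ i $ j)) 0 = 0" "fps_nth (?e (U $ i $ j)) 1 = 0"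
    "fps_nth (?e (U $ i $ j)) 2 = (if i = j then d i else 0)" for i j
    using jet[unfolded two_jet_def, rule_format, of i j]
    by (auto simp: mps_eval_add e_mat mat_nth split: if_splits)
  have sq: "fps_nth (?e ((U ** U) $ i $ j)) 2 = 0" for i j
    by (simp add: matrix_mult_nth mps_eval_sum mps_eval_mult[of P, OF P] fps_sum_nth
        fps_mult_nth_2 low low(2)[unfolded One_nat_def])
  \<comment> \<open>The sum stops at \<open>n\<close> because \<open>mat_power U k\<close> has order
    at least \<open>k\<close> in the variables.\<close>
  have nth: "fps_nth (?e (mat_binomial_sqrt U $ i $ j)) n =
      (\<Sum>k | k \<le> n. ((1/2) gchoose k) * fps_nth (?e (mat_power U k $ i $ j)) n)" for i j n
    unfolding mat_binomial_sqrt_def vec_lambda_beta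
    by (subst mps_eval_mps_sum[OF mps_vanish_binomial_term[OF U]])
      (auto simp: mps_eval_mult[of P, OF P])
  have sets: "{k. k \<le> 1} = {0, 1::nat}" "{k. k \<le> 2} = {0, 1, 2::nat}"
    by auto
  have pow: "mat_power U 0 = mat 1" "mat_power U 1 = U" "mat_power U 2 = U ** U"
    by (simp_all add: mat_power_def numeral_2_eq_2)
  show ?thesis
    unfolding two_jet_def nth_map_matrix nth sets
    by (simp add: pow[simplified] low low(2)[unfolded One_nat_def] sq e_mat mat_nth)
qed

text \<open>The Chern lift satisfies \<open>\<phi>(x)\<^sup>t \<phi>(x) = (x\<^sup>t x)\<^sup>(\<^sup>p\<^sup>)\<close>, so its diagonal is determined to second
  order by that of \<open>x\<^sup>t x\<close>.\<close>

lemma two_jet_chern_image: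
  fixes P :: "'n \<times> 'n::finite \<Rightarrow> complex fps"
  assumes p: "p \<ge> 3" and P: "\<And>v. fps_nth (P v) 0 = 0" and P1: "\<And>i. fps_nth (P (i, i)) 1 = 0"
  defines "Y \<equiv> map_matrix (mps_eval P) x_mat"
  shows "two_jet (map_matrix (mps_eval P) (chern_image p))
    (\<lambda>i. of_nat p / 2 * fps_nth ((transpose Y ** Y) $ i $ i) 2)"
proof -
  let ?e = "map_matrix (mps_eval P)" and ?m = "\<lambda>i. fps_nth ((transpose Y ** Y) $ i $ i) 2"
  let ?x = "x_mat :: ('n \<times> 'n, complex) mps ^ 'n ^ 'n"
  have e_mult: "?e (A ** B) = ?e A ** ?e B" for A B :: "('n \<times> 'n, complex) mps ^ 'n ^ 'n"
    by (rule map_matrix_mult) (simp_all add: mps_eval_add mps_eval_mult[of P, OF P])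
  have e_pow: "?e (entry_power A k) = entry_power (?e A) k" for A :: "('n \<times> 'n, complex) mps ^ 'n ^ 'n" and k
    by (rule matrix_eqI) (simp add: entry_power_nth mps_eval_power[of P, OF P])
  have e_transpose: "?e (transpose A) = transpose (?e A)" for A :: "('n \<times> 'n, complex) mps ^ 'n ^ 'n"
    by (rule matrix_eqI) (simp add: transpose_nth)
  have Y: "Y $ i $ j = (if i = j then 1 else 0) + P (i, j)" for i j
    by (simp add: Y_def x_mat_def mps_eval_add mps_eval_var[of P, OF P] mat_nth)
  have Y0: "fps_nth (Y $ i $ j) 0 = (if i = j then 1 else 0)" and Y1: "fps_nth (Y $ i $ i) 1 = 0" for i j
    using P P1[of i] by (simp_all add: Y)
  have jY: "two_jet (entry_power Y p) (\<lambda>i. of_nat p * fps_nth (Y $ i $ i) 2)"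
    by (rule two_jet_entry_power[OF p Y0 Y1])
  have jG: "two_jet (entry_power (transpose Y ** Y) p) (\<lambda>i. of_nat p * ?m i)"
  proof (rule two_jet_entry_power[OF p])
    show "fps_nth ((transpose Y ** Y) $ i $ j) 0 = (if i = j then 1 else 0)" for i j
      by (simp add: matrix_mult_nth transpose_nth fps_sum_nth Y0
          if_distrib[of "\<lambda>c. _ * c"] cong: if_cong)
    show "fps_nth ((transpose Y ** Y) $ i $ i) 1 = 0" for i
      using Y1 by (simp add: matrix_mult_nth transpose_nth fps_sum_nth Y0 fps_mult_nth_1 sum.distrib
          if_distrib[of "\<lambda>c. _ * c"] if_distrib[of "\<lambda>c. c * _"] cong: if_cong)
  qed
  define B where "B = transpose (entry_power ?x p) ** entry_power ?x p"
  have eB: "?e B = transpose (entry_power Y p) ** entry_power Y p"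
    by (simp add: B_def e_mult e_transpose e_pow Y_def)
  have "const_part B = mat 1"
    unfolding B_def by (rule const_part_gram) (use p in simp)
  then have "matrix_inv B ** B = mat 1"
    unfolding const_part_def by (rule mps_matrix_inverse(2))
  then have "?e (matrix_inv B) ** ?e B = ?e (mat 1)"
    by (metis e_mult)
  also have "\<dots> = mat 1"
    by (rule matrix_eqI) (simp add: mat_nth)
  \<comment> \<open>Writing y for the quadratic coefficient of a diagonal entry of \<open>Y\<close>,
    the Gram matrix of the entrywise power contributes p y + p y, and the inverse changes the
    sign.\<close>
  finally have "two_jet (?e (matrix_inv B))
      (\<lambda>i. - (of_nat p * fps_nth (Y $ i $ i) 2 + of_nat p * fps_nth (Y $ i $ i) 2))"
    by (rule two_jet_left_inverse[rotated])
      (unfold eB, rule two_jet_mult[OF two_jet_transpose[OF jY] jY])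
  from two_jet_mult[OF this jG] have "two_jet (?e (chern_arg p))
      (\<lambda>i. of_nat p * ?m i - 2 * (of_nat p * fps_nth (Y $ i $ i) 2))"
    by (simp add: chern_arg_def B_def e_mult e_transpose e_pow Y_def[symmetric] algebra_simps)
  then have "two_jet (?e (mat_binomial_sqrt (chern_arg p - mat 1)))
      (\<lambda>i. (of_nat p * ?m i - 2 * (of_nat p * fps_nth (Y $ i $ i) 2)) / 2)"
    by (intro two_jet_mat_binomial_sqrt[OF P const_part_chern_arg]) (use p in simp_all)
  \<comment> \<open>The square root has diagonal (p m - 2 p y)/2, with m that of
    \<open>transpose Y ** Y\<close>; the outer factor adds p y, so y cancels and p m / 2
    remains.\<close>
  from two_jet_mult[OF jY this] show ?thesis
    by (simp add: chern_image_eq e_mult e_pow Y_def[symmetric] field_simps)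
qed

section \<open>How the lifts move curves\<close>

lemma const_part_eval:
  assumes "const_part C = mat 1"
  shows "fps_nth (mps_eval P ((C - mat 1) $ i $ j)) 0 = 0"
  using arg_cong[OF assms, of "\<lambda>A. A $ i $ j"]
  by (auto simp: mps_eval_nth_0 const_part_nth mat_nth)

text \<open>The variables are the entries of T = x - 1, so a matrix curve \<open>Y\<close> through 1
  corresponds to the point \<open>Y - mat 1\<close>.\<close>

lemma mps_eval_x_mat:
  assumes "\<And>i j. fps_nth (Y $ i $ j) 0 = mat 1 $ i $ j"
  shows "map_matrix (mps_eval (\<lambda>(i, j). (Y - mat 1) $ i $ j)) x_mat = Y"
proof -
  have "fps_nth ((\<lambda>(i, j). (Y - mat 1) $ i $ j) v) 0 = 0" for v
    using assms by (auto simp: mat_nth split: prod.splits)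
  then show ?thesis
    by (intro matrix_eqI) (simp add: x_mat_def mps_eval_add mps_eval_var mat_nth)
qed

lemma mps_map_id_on:
  assumes "f \<in> mps_over S" "\<And>z. z \<in> S \<Longrightarrow> \<sigma> z = z"
  shows "mps_map \<sigma> f = f"
  using assms by (intro mps_eqI) (simp add: mps_map_def mps_over_def)

text \<open>On coefficients in the fixed set \<open>S\<close> the twist by \<open>\<sigma>\<close>
  is trivial, and what remains is composition: the lift replaces the curve by its image under
  \<open>C\<close>. Both composites in the curvature are thereby reduced to matrix computations over
  one-variable series.\<close>

lemma mps_eval_frob:
  fixes C :: "('n \<times> 'n, complex) mps ^ 'n ^ 'n::finite"
  assumes P: "\<And>v. fps_nth (P v) 0 = 0" and C: "const_part C = mat 1"
    and f: "f \<in> mps_over S" and S: "\<And>z. z \<in> S \<Longrightarrow> \<sigma> z = z"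
  shows "mps_eval P (mps_subst \<sigma> (\<lambda>(i, j). (C - mat 1) $ i $ j) f) =
    mps_eval (\<lambda>(i, j). (map_matrix (mps_eval P) C - mat 1) $ i $ j) f"
proof -
  have C0: "mps_coeff ((\<lambda>(i, j). (C - mat 1) $ i $ j) v) 0 = 0" for v
    using const_part_eval[OF C, of P] by (auto simp: mps_eval_nth_0 split: prod.splits)
  have "(\<lambda>v. mps_eval P ((\<lambda>(i, j). (C - mat 1) $ i $ j) v)) =
      (\<lambda>(i, j). (map_matrix (mps_eval P) C - mat 1) $ i $ j)"
    by (auto simp: fun_eq_iff mps_eval_diff mat_nth)
  then show ?thesis
    by (simp only: mps_eval_subst[of P, OF P C0] mps_map_id_on[OF f S])
qed

section \<open>A unitary curve\<close>

text \<open>Pairing \<open>Inl k\<close> with \<open>Inr k\<close> makes the blocks satisfy a = d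
  and b = -c, so the linear generators of the ideal vanish along the curve, in addition to
  orthogonality.\<close>

definition rotation_mat :: "'r::finite \<Rightarrow> complex fps ^ ('r + 'r) ^ ('r + 'r)"
  where "rotation_mat k = (\<chi> i j.
    if i = j then (if i = Inl k \<or> i = Inr k then fps_cos 1 else 1)
    else if i = Inr k \<and> j = Inl k then fps_sin 1
    else if i = Inl k \<and> j = Inr k then - fps_sin 1 else 0)"

lemma rotation_mat_nth_0: "fps_nth (rotation_mat k $ i $ j) 0 = mat 1 $ i $ j"
  by (auto simp: rotation_mat_def mat_nth)

lemma rotation_mat_nth_1: "fps_nth (rotation_mat k $ i $ i) 1 = 0"
  by (simp add: rotation_mat_def)

lemma rotation_mat_nth_2: "fps_nth (rotation_mat k $ Inl k $ Inl k) 2 = - 1 / 2"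
  using fps_cos_nth_add_2[of "1 :: complex" 0] by (simp add: rotation_mat_def numeral_2_eq_2)

lemma rotation_mat_orthogonal: "transpose (rotation_mat k) ** rotation_mat k = mat 1"
proof (rule matrix_eqI)
  fix i j :: "'a + 'a"
  let ?R = "rotation_mat k"
  have cs: "fps_cos 1 * fps_cos 1 + fps_sin 1 * fps_sin 1 = (1 :: complex fps)"
    using fps_sin_cos_sum_of_squares[of "1 :: complex"] by (simp add: power2_eq_square)
  then have sc: "fps_sin 1 * fps_sin 1 + fps_cos 1 * fps_cos 1 = (1 :: complex fps)"
    by (simp add: add.commute)
  have R: "?R $ Inl k $ Inl k = fps_cos 1" "?R $ Inr k $ Inr k = fps_cos 1"
    "?R $ Inr k $ Inl k = fps_sin 1" "?R $ Inl k $ Inr k = - fps_sin 1"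
    by (simp_all add: rotation_mat_def)
  show "(transpose ?R ** ?R) $ i $ j = mat 1 $ i $ j"
  proof (cases "i = Inl k \<or> i = Inr k")
    case True
    \<comment> \<open>A column indexed in the rotated plane is supported on that plane; any other
      column is a standard basis vector.\<close>
    have "(transpose ?R ** ?R) $ i $ j = (\<Sum>l\<in>{Inl k, Inr k}. ?R $ l $ i * ?R $ l $ j)"
      unfolding matrix_mult_nth transpose_nth
      by (rule sum.mono_neutral_right) (use True in \<open>auto simp: rotation_mat_def\<close>)
    also have "\<dots> = ?R $ Inl k $ i * ?R $ Inl k $ j + ?R $ Inr k $ i * ?R $ Inr k $ j"
      by simp
    also have "\<dots> = mat 1 $ i $ j"
    proof (cases "j = Inl k \<or> j = Inr k")
      case j: True
      with True show ?thesis
        by (elim disjE) (simp_all add: R mat_nth cs sc)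
    next
      case False
      then have "?R $ Inl k $ j = 0" "?R $ Inr k $ j = 0"
        by (auto simp: rotation_mat_def)
      then show ?thesis
        using True False by (auto simp: mat_nth)
    qed
    finally show ?thesis .
  next
    case False
    have "(transpose ?R ** ?R) $ i $ j = (\<Sum>l\<in>{i}. ?R $ l $ i * ?R $ l $ j)"
      unfolding matrix_mult_nth transpose_nth
      by (rule sum.mono_neutral_right) (use False in \<open>auto simp: rotation_mat_def\<close>)
    also have "\<dots> = mat 1 $ i $ j"
      using False by (auto simp: rotation_mat_def mat_nth)
    finally show ?thesis .
  qed
qed

definition rotation_point :: "'r::finite \<Rightarrow> ('r + 'r) \<times> ('r + 'r) \<Rightarrow> complex fps"
  where "rotation_point k = (\<lambda>(i, j). (rotation_mat k - mat 1) $ i $ j)"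

lemma rotation_point_nth_0: "fps_nth (rotation_point k v) 0 = 0"
  by (cases v) (auto simp: rotation_point_def rotation_mat_nth_0 mat_nth)

lemma rotation_point_nth_1: "fps_nth (rotation_point k (i, i)) 1 = 0"
  using rotation_mat_nth_1[of k i] by (simp add: rotation_point_def mat_nth)

lemma mps_eval_rotation_point_x_mat: "map_matrix (mps_eval (rotation_point k)) x_mat = rotation_mat k"
  unfolding rotation_point_def by (rule mps_eval_x_mat[OF rotation_mat_nth_0])

section \<open>The rings and the unitary ideal\<close>

lemma ring_of_type_algebra_simps [simp]:
  "carrier ring_of_type_algebra = UNIV"
  "\<one>\<^bsub>ring_of_type_algebra\<^esub> = 1"
  "\<zero>\<^bsub>ring_of_type_algebra\<^esub> = 0"
  "x \<otimes>\<^bsub>ring_of_type_algebra\<^esub> y = x * y"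
  "x \<oplus>\<^bsub>ring_of_type_algebra\<^esub> y = x + y"
  by (simp_all add: ring_of_type_algebra_def)

lemma ring_unital_subring:
  assumes "unital_subring (T :: 'a::comm_ring_1 set)"
  shows "ring (ring_of_type_algebra\<lparr>carrier := T\<rparr>)"
proof (intro ringI abelian_groupI monoidI)
  fix x assume "x \<in> carrier (ring_of_type_algebra\<lparr>carrier := T\<rparr>)"
  then show "\<exists>y\<in>carrier (ring_of_type_algebra\<lparr>carrier := T\<rparr>).
      y \<oplus>\<^bsub>ring_of_type_algebra\<lparr>carrier := T\<rparr>\<^esub> x = \<zero>\<^bsub>ring_of_type_algebra\<lparr>carrier := T\<rparr>\<^esub>"
    using unital_subring_closed[OF assms] by (auto intro!: bexI[of _ "- x"])
qed (use unital_subring_closed[OF assms] in \<open>auto simp: algebra_simps\<close>)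

lemma unital_subring_ring_A: "unital_subring (carrier (ring_A M \<zeta>))"
proof -
  interpret cring "ring_of_type_algebra :: complex ring"
    by (rule cring_from_type_algebra)
  have minus: "\<ominus>\<^bsub>ring_of_type_algebra\<^esub> z = - z" for z :: complex
    by (rule minus_equality) (simp_all add: ring_of_type_algebra_def)
  let ?G = "generate_ring ring_of_type_algebra {1 / of_nat M, \<zeta>}"
  have "1 \<in> ?G"
    using generate_ring.one[of ring_of_type_algebra] by (simp add: ring_of_type_algebra_def)
  moreover have add: "x + y \<in> ?G" if "x \<in> ?G" "y \<in> ?G" for x y
    using generate_ring.eng_add[OF that] by (simp add: ring_of_type_algebra_def)
  moreover have "x * y \<in> ?G" if "x \<in> ?G" "y \<in> ?G" for x y
    using generate_ring.eng_mult[OF that] by (simp add: ring_of_type_algebra_def)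
  moreover have "- x \<in> ?G" if "x \<in> ?G" for x
    using generate_ring.a_inv[OF that] by (simp add: minus)
  ultimately show ?thesis
    by (simp add: unital_subring_def ring_A_def) (metis diff_conv_add_uminus)
qed

lemma inverse_M_in_ring_A: "1 / of_nat M \<in> carrier (ring_A M \<zeta>)"
  by (simp add: ring_A_def generate_ring.incl)

lemma ring_AT_eq: "ring_AT M \<zeta> = ring_of_type_algebra\<lparr>carrier := mps_over (carrier (ring_A M \<zeta>))\<rparr>"
  by (simp add: ring_AT_def mps_over_def)

lemma ring_ring_AT: "ring (ring_AT M \<zeta>)"
  unfolding ring_AT_eq by (intro ring_unital_subring unital_subring_mps_over unital_subring_ring_A)

definition unitary_gens :: "(('r::finite + 'r) \<times> ('r + 'r), complex) mps set"
  where "unitary_gens = {(transpose x_mat ** x_mat - mat 1) $ i $ j |i j. True} \<union>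
      {x_mat $ Inl i $ Inl j - x_mat $ Inr i $ Inr j |i j. True} \<union>
      {x_mat $ Inl i $ Inr j + x_mat $ Inr i $ Inl j |i j. True}"

lemma unitary_ideal_eq: "unitary_ideal M \<zeta> = genideal (ring_AT M \<zeta>) unitary_gens"
  by (simp add: unitary_ideal_def unitary_gens_def)

lemma unitary_gens_subset: "unitary_gens \<subseteq> carrier (ring_AT M \<zeta>)"
proof -
  let ?T = "mps_over (carrier (ring_A M \<zeta>)) :: (('a + 'a) \<times> ('a + 'a), complex) mps set"
  have T: "unital_subring ?T" and x: "x_mat \<in> mat_over ?T"
    by (intro unital_subring_mps_over x_mat_over unital_subring_ring_A)+
  have "transpose x_mat ** x_mat - mat 1 \<in> mat_over ?T"
    by (intro mat_over_diff mat_over_mult mat_over_transpose mat_over_1 T x)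
  then show ?thesis
    using unital_subring_closed(4,5)[OF T] mat_over_nth[OF x]
    by (auto simp: unitary_gens_def ring_AT_eq mat_over_nth simp del: vector_minus_component)
qed

lemma mps_eval_unitary_gens:
  assumes "g \<in> unitary_gens"
  shows "mps_eval (rotation_point k) g = 0"
proof -
  let ?e = "mps_eval (rotation_point k)"
  have x: "?e (x_mat $ i $ j) = rotation_mat k $ i $ j" for i j
    using arg_cong[OF mps_eval_rotation_point_x_mat, of "\<lambda>A. A $ i $ j"] by simp
  have e_mat: "?e (mat 1 $ i $ j) = mat 1 $ i $ j" for i j
    by (simp add: mat_nth)
  have "?e ((transpose x_mat ** x_mat) $ i $ j) = (transpose (rotation_mat k) ** rotation_mat k) $ i $ j" for i j
    by (simp add: matrix_mult_nth mps_eval_sum mps_eval_mult rotation_point_nth_0 transpose_nth x)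
  then have "?e ((transpose x_mat ** x_mat) $ i $ j) = mat 1 $ i $ j" for i j
    by (simp add: rotation_mat_orthogonal)
  then show ?thesis
    using assms by (auto simp: unitary_gens_def mps_eval_diff mps_eval_add e_mat x rotation_mat_def)
qed

text \<open>The series in A[[T]] that vanish along the curve form an ideal containing the
  generators, hence containing the ideal they generate. A nonzero value along the curve thus
  certifies that a series lies outside \<open>K\<close>.\<close>

lemma mps_eval_unitary_ideal:
  assumes "g \<in> unitary_ideal M \<zeta>"
  shows "mps_eval (rotation_point k) g = 0"
proof -
  let ?R = "ring_AT M \<zeta> :: (('a + 'a) \<times> ('a + 'a), complex) mps ring" and ?e = "mps_eval (rotation_point k)"
  interpret ring ?R by (rule ring_ring_AT)
  have T: "unital_subring (carrier ?R)"
    by (simp add: ring_AT_eq unital_subring_mps_over unital_subring_ring_A)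
  have "ideal {f \<in> carrier ?R. ?e f = 0} ?R"
  proof (rule idealI[OF ring_axioms])
    show "subgroup {f \<in> carrier ?R. ?e f = 0} (add_monoid ?R)"
    proof (rule add.subgroupI)
      fix f assume f: "f \<in> {f \<in> carrier ?R. ?e f = 0}"
      have minus: "\<ominus>\<^bsub>?R\<^esub> f = - f"
        by (rule minus_equality) (use f unital_subring_closed(3)[OF T] in \<open>auto simp: ring_AT_eq\<close>)
      show "\<ominus>\<^bsub>?R\<^esub> f \<in> {f \<in> carrier ?R. ?e f = 0}"
        unfolding minus
        using f unital_subring_closed(3)[OF T] mps_eval_diff[of "rotation_point k" 0 f] by simp
    qed (use unital_subring_closed[OF T] in \<open>auto simp: ring_AT_eq mps_eval_add intro!: exI[of _ 0]\<close>)
  qed (use unital_subring_closed[OF T] in \<open>auto simp: ring_AT_eq mps_eval_mult rotation_point_nth_0\<close>)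
  moreover have "unitary_gens \<subseteq> {f \<in> carrier ?R. ?e f = 0}"
    using unitary_gens_subset mps_eval_unitary_gens by auto
  ultimately show ?thesis
    using assms unfolding unitary_ideal_eq genideal_def by blast
qed

section \<open>The curvature of a diagonal variable\<close>

text \<open>The integer \<open>M\<close> is fixed, so the image of 1/M is again an inverse of
  \<open>M\<close> and equals 1/M. For \<open>M = 2 * m\<close> this makes 1/2 = m/M a fixed
  element, which the binomial coefficients require.\<close>

lemma frobenius_lift_fixed:
  assumes M: "M > 0" "even M" and frob: "frobenius_lift (ring_A M \<zeta>) p \<phi>"
  shows "\<phi> 0 = 0" "\<phi> 1 = 1"
    and "unital_subring {z \<in> carrier (ring_A M \<zeta>). \<phi> z = z}"
    and "1/2 \<in> {z \<in> carrier (ring_A M \<zeta>). \<phi> z = z}"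
proof -
  let ?A = "carrier (ring_A M \<zeta>)" and ?S = "{z \<in> carrier (ring_A M \<zeta>). \<phi> z = z}"
  note A = unital_subring_closed[OF unital_subring_ring_A[of M \<zeta>]]
  have hom: "\<phi> \<in> ring_hom (ring_A M \<zeta>) (ring_A M \<zeta>)"
    using frob by (simp add: frobenius_lift_def)
  have add: "\<phi> (x + y) = \<phi> x + \<phi> y" and mult: "\<phi> (x * y) = \<phi> x * \<phi> y" if "x \<in> ?A" "y \<in> ?A" for x y
    using ring_hom_add[OF hom that] ring_hom_mult[OF hom that] by (simp_all add: ring_A_def)
  show one: "\<phi> 1 = 1"
    using ring_hom_one[OF hom] by (simp add: ring_A_def)
  show "\<phi> 0 = 0"
    using add[OF A(1) A(1)] by simp
  have diff: "\<phi> (x - y) = \<phi> x - \<phi> y" if "x \<in> ?A" "y \<in> ?A" for x y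
    using add[OF A(4)[OF that] that(2)] by simp
  show S: "unital_subring ?S"
    using A one diff mult by (simp add: unital_subring_def)
  have inv: "1 / of_nat M \<in> ?A"
    by (rule inverse_M_in_ring_A)
  have "of_nat M \<in> ?S"
    by (rule unital_subring_of_nat[OF S])
  then have "of_nat M * \<phi> (1 / of_nat M) = 1"
    using mult[of "of_nat M" "1 / of_nat M"] inv one M(1) by simp
  then have "1 / of_nat M \<in> ?S"
    using inv M(1) by (simp add: field_simps)
  moreover obtain m where "M = 2 * m"
    using M(2) by blast
  ultimately have half: "of_nat m * (1 / of_nat M) \<in> ?S"
    using unital_subring_closed(6)[OF S] unital_subring_of_nat[OF S] by blast
  have eq: "of_nat m * (1 / of_nat M) = (1/2 :: complex)"
    using \<open>M = 2 * m\<close> M(1) by simp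
  show "1/2 \<in> ?S"
    using half unfolding eq .
qed

text \<open>The inner, trivial lift turns the variable into a polynomial with integer coefficients,
  so the outer twist is harmless. The Chern lift then carries the rotation to a curve whose diagonal
  entry is 1 modulo t^3, and so is the \<open>p'\<close>-th power of that entry.\<close>

lemma mps_eval_chern_triv:
  fixes k :: "'r::finite"
  assumes p: "p \<ge> 3" and p': "p' > 0"
    and S: "unital_subring S" "\<And>z. z \<in> S \<Longrightarrow> \<sigma> z = z" and \<sigma>': "\<sigma>' 0 = 0" "\<sigma>' 1 = 1"
  shows "fps_nth (mps_eval (rotation_point k)
    (chern_frob \<sigma> p (triv_frob \<sigma>' p' (mps_var (Inl k, Inl k))))) 2 = 0"
proof -
  let ?P = "rotation_point k" and ?a = "Inl k :: 'r + 'r"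
  let ?x = "x_mat :: (('r + 'r) \<times> ('r + 'r), complex) mps ^ ('r + 'r) ^ ('r + 'r)"
  define g where "g = (?x $ ?a $ ?a) ^ p' - 1"
  have g: "triv_frob \<sigma>' p' (mps_var (?a, ?a)) = g"
    by (simp add: triv_frob_def mps_subst_var \<sigma>' g_def entry_power_nth mat_nth)
  have gS: "g \<in> mps_over S"
    unfolding g_def
    by (intro unital_subring_closed(2,4) unital_subring_power unital_subring_mps_over S(1)
        mat_over_nth[OF x_mat_over])
  define Y where "Y = map_matrix (mps_eval ?P) (chern_image p)"
  define Q where "Q = (\<lambda>(i, j). (Y - mat 1) $ i $ j)"
  \<comment> \<open>Along the rotation the Gram matrix is 1, so its quadratic coefficient is
    zero.\<close>
  have "two_jet Y (\<lambda>i. of_nat p / 2 * fps_nth (mat 1 $ i $ i) 2)"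
    using two_jet_chern_image[OF p, of ?P, OF rotation_point_nth_0 rotation_point_nth_1]
    by (simp add: mps_eval_rotation_point_x_mat rotation_mat_orthogonal Y_def)
  then have Y: "fps_nth (Y $ i $ j) 0 = mat 1 $ i $ j" "fps_nth (Y $ ?a $ ?a) 1 = 0"
      "fps_nth (Y $ ?a $ ?a) 2 = 0" for i j
    by (simp_all add: two_jet_def mat_nth)
  have Q: "fps_nth (Q v) 0 = 0" for v
    by (cases v) (auto simp: Q_def Y mat_nth)
  have "mps_eval ?P (chern_frob \<sigma> p g) = mps_eval Q g"
    unfolding chern_frob_def Q_def Y_def
    by (rule mps_eval_frob[OF rotation_point_nth_0 const_part_chern_image gS S(2)]) (use p in auto)
  also have "\<dots> = (Y $ ?a $ ?a) ^ p' - 1"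
    using arg_cong[OF mps_eval_x_mat[of Y, OF Y(1), folded Q_def], of "\<lambda>A. A $ ?a $ ?a"]
    by (simp add: g_def mps_eval_diff mps_eval_power[of Q, OF Q])
  finally show ?thesis
    using fps_nth_power_second_order(3)[of "Y $ ?a $ ?a" p'] Y by (simp add: g mat_nth)
qed

text \<open>The inner series is now an entry of the Chern image, with coefficients in the ring
  generated by 1/2, whence the condition on \<open>S\<close>. The outer lift replaces the rotation
  by its entrywise \<open>p'\<close>-th power, which is no longer orthogonal at order t^2.\<close>

lemma mps_eval_triv_chern:
  fixes k :: "'r::finite"
  assumes p: "p \<ge> 3" and p': "p' \<ge> 3"
    and S: "unital_subring S" "1/2 \<in> S" "\<And>z. z \<in> S \<Longrightarrow> \<sigma>' z = z" and \<sigma>: "\<sigma> 0 = 0" "\<sigma> 1 = 1"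
  shows "fps_nth (mps_eval (rotation_point k)
    (triv_frob \<sigma>' p' (chern_frob \<sigma> p (mps_var (Inl k, Inl k))))) 2 = - (of_nat p * of_nat p' / 2)"
proof -
  let ?P = "rotation_point k" and ?a = "Inl k :: 'r + 'r"
  let ?x = "x_mat :: (('r + 'r) \<times> ('r + 'r), complex) mps ^ ('r + 'r) ^ ('r + 'r)"
  define g where "g = chern_image p $ ?a $ ?a - 1"
  have g: "chern_frob \<sigma> p (mps_var (?a, ?a)) = g"
    by (simp add: chern_frob_def mps_subst_var \<sigma> g_def mat_nth)
  have gS: "g \<in> mps_over S"
    unfolding g_def
    by (intro unital_subring_closed(2,4) unital_subring_mps_over S mat_over_nth[OF chern_image_over])
      (use p in simp)
  define Y where "Y = entry_power (rotation_mat k) p'"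
  define Q where "Q = (\<lambda>(i, j). (Y - mat 1) $ i $ j)"
  have eY: "map_matrix (mps_eval ?P) (entry_power ?x p') = Y"
    unfolding Y_def mps_eval_rotation_point_x_mat[symmetric]
    by (rule matrix_eqI) (simp add: entry_power_nth mps_eval_power rotation_point_nth_0)
  have jY: "two_jet Y (\<lambda>i. of_nat p' * fps_nth (rotation_mat k $ i $ i) 2)"
    unfolding Y_def by (rule two_jet_entry_power[OF p'])
      (simp_all add: rotation_mat_nth_0 rotation_mat_nth_1[simplified] mat_nth)
  have Y: "fps_nth (Y $ i $ j) 0 = mat 1 $ i $ j" "fps_nth (Y $ i $ j) 1 = 0" for i j
    using jY by (simp_all add: two_jet_def mat_nth)
  have Q: "fps_nth (Q v) 0 = 0" "fps_nth (Q v) 1 = 0" for v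
    by (cases v; auto simp: Q_def Y Y(2)[simplified] mat_nth)+
  \<comment> \<open>Each factor contributes \<open>p'\<close> times the coefficient -1/2 of the
    cosine.\<close>
  have "fps_nth ((transpose Y ** Y) $ ?a $ ?a) 2 = - of_nat p'"
    using two_jet_mult[OF two_jet_transpose[OF jY] jY]
    by (simp add: two_jet_def rotation_mat_nth_2)
  moreover have "map_matrix (mps_eval Q) x_mat = Y"
    unfolding Q_def by (rule mps_eval_x_mat) (rule Y)
  ultimately have "fps_nth (mps_eval Q (chern_image p $ ?a $ ?a)) 2 = of_nat p / 2 * - of_nat p'"
    using two_jet_chern_image[OF p, of Q, OF Q] by (simp add: two_jet_def)
  moreover have "mps_eval ?P (triv_frob \<sigma>' p' g) = mps_eval Q g"
    unfolding triv_frob_def Q_def eY[symmetric]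
    by (rule mps_eval_frob[OF rotation_point_nth_0 _ gS S(3)])
      (use p' in \<open>simp_all add: const_part_entry_power\<close>)
  ultimately show ?thesis
    by (simp add: g g_def mps_eval_diff)
qed

theorem theorem3p7:
  fixes M N :: nat and \<zeta> :: complex and V :: "nat set"
    and \<sigma> :: "nat \<Rightarrow> complex \<Rightarrow> complex"
  assumes "M > 0" and "even M" and "N \<ge> 1"
    and "\<zeta> ^ N = 1" and "\<And>k. 0 < k \<Longrightarrow> k < N \<Longrightarrow> \<zeta> ^ k \<noteq> 1"
    and "\<And>p. p \<in> V \<Longrightarrow> prime p \<and> \<not> p dvd M * N"
    and "\<And>p. p \<in> V \<Longrightarrow> frobenius_lift (ring_A M \<zeta>) p (\<sigma> p)"
  shows "\<forall>p\<in>V. \<forall>p'\<in>V. \<exists>P Q.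
    (P, Q) \<in> (unitary_curvature M \<zeta> \<sigma> p p' ::
      ((('r::finite + 'r) \<times> ('r + 'r), complex) mps set \<times>
       (('r + 'r) \<times> ('r + 'r), complex) mps set) set) \<and>
    Q \<noteq> \<zero>\<^bsub>ring_AT M \<zeta> Quot unitary_ideal M \<zeta>\<^esub>"
proof (intro ballI)
  fix p p' assume V: "p \<in> V" "p' \<in> V"
  let ?R = "ring_AT M \<zeta> :: (('r + 'r) \<times> ('r + 'r), complex) mps ring"
  let ?K = "unitary_ideal M \<zeta> :: (('r + 'r) \<times> ('r + 'r), complex) mps set"
  interpret ring ?R by (rule ring_ring_AT)
  \<comment> \<open>Since \<open>M\<close> is even, 2 divides \<open>M * N\<close> and is excluded
    from \<open>V\<close>.\<close>
  have ge3: "q \<ge> 3" if "q \<in> V" for q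
  proof -
    have "q \<noteq> 2" "q \<ge> 2"
      using assms(2) assms(6)[OF that] by (auto intro: prime_ge_2_nat)
    then show ?thesis by simp
  qed
  note fixed = frobenius_lift_fixed[OF assms(1,2,7)]
  \<comment> \<open>Any index serves; the inhabited type \<open>'r\<close> encodes r \<ge>
    1.\<close>
  define k :: 'r where "k = undefined"
  define f :: "(('r + 'r) \<times> ('r + 'r), complex) mps" where "f = mps_var (Inl k, Inl k)"
  define c where "c = (1 / of_nat (if p = p' then p else p * p') :: complex)"
  have pos: "p > 0" "p' > 0"
    using ge3[OF V(1)] ge3[OF V(2)] by simp_all
  then have "c \<noteq> 0"
    by (simp add: c_def)
  \<comment> \<open>In each composite \<open>S\<close> is the part of \<open>A\<close> fixed by the
    Frobenius lift of the outer map, here the one at \<open>p\<close>.\<close>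
  have "fps_nth (mps_eval (rotation_point k) (chern_frob (\<sigma> p) p (triv_frob (\<sigma> p') p' f))) 2 = 0"
    unfolding f_def
    by (rule mps_eval_chern_triv[where S = "{z \<in> carrier (ring_A M \<zeta>). \<sigma> p z = z}"])
      (use ge3[OF V(1)] pos fixed(3)[OF V(1)] fixed(1,2)[OF V(2)] in simp_all)
  moreover have "fps_nth (mps_eval (rotation_point k) (triv_frob (\<sigma> p') p' (chern_frob (\<sigma> p) p f))) 2 =
      - (of_nat p * of_nat p' / 2)"
    unfolding f_def
    by (rule mps_eval_triv_chern[where S = "{z \<in> carrier (ring_A M \<zeta>). \<sigma> p' z = z}"])
      (use ge3[OF V(1)] ge3[OF V(2)] fixed(3,4)[OF V(2)] fixed(1,2)[OF V(1)] in simp_all)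
  ultimately have "fps_nth (mps_eval (rotation_point k) (curvature11 \<sigma> p p' f)) 2 =
      c * (of_nat p * of_nat p' / 2)"
    unfolding curvature11_def c_def[symmetric]
    by (simp only: mps_eval_mult[of "rotation_point k", OF rotation_point_nth_0] mps_eval_diff
        mps_eval_const fps_mult_left_const_nth fps_sub_nth) simp
  then have "mps_eval (rotation_point k) (curvature11 \<sigma> p p' f) \<noteq> 0"
    using \<open>c \<noteq> 0\<close> pos by (auto dest: arg_cong[of _ _ "\<lambda>s. fps_nth s 2"])
  then have notin: "curvature11 \<sigma> p p' f \<notin> ?K"
    using mps_eval_unitary_ideal by blast
  \<comment> \<open>The zero class is \<open>?K\<close> itself. As 0 lies in \<open>?K\<close>, a
    coset contains its representative, so a representative outside \<open>?K\<close> gives a nonzero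
    class.\<close>
  have "0 \<in> ?K"
    using additive_subgroup.zero_closed[OF ideal.axioms(1)[OF genideal_ideal[OF unitary_gens_subset]]]
    by (simp add: unitary_ideal_eq ring_AT_eq)
  then have "curvature11 \<sigma> p p' f \<in> ?K +>\<^bsub>?R\<^esub> curvature11 \<sigma> p p' f"
    by (force simp: a_r_coset_def' ring_AT_eq)
  with notin have "?K +>\<^bsub>?R\<^esub> curvature11 \<sigma> p p' f \<noteq> \<zero>\<^bsub>?R Quot ?K\<^esub>"
    by (auto simp: FactRing_def)
  moreover have "f \<in> carrier ?R"
    by (simp add: f_def ring_AT_eq mps_over_var unital_subring_ring_A)
  ultimately show "\<exists>P Q. (P, Q) \<in> unitary_curvature M \<zeta> \<sigma> p p' \<and> Q \<noteq> \<zero>\<^bsub>?R Quot ?K\<^esub>"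
    unfolding unitary_curvature_def induced_graph_def by blast
qed

end
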